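(* Let $\Lambda$ be an artin algebra, let $\Phi:\mathrm{maps}(\mathrm{mod}\,\Lambda)\to\mathrm{mod}(\mathrm{mod}\,\Lambda)$ be the functor $\Phi(A_1\xrightarrow{f}A_0)=\mathrm{Coker}\big((-,A_1)\xrightarrow{(-,f)}(-,A_0)\big)$, and let $\mathscr{C}\subset\mathrm{maps}(\mathrm{mod}\,\Lambda)$ be a subcategory which contains all objects of the form $(M,0,0)$ and $(M,M,1_M)$ with $M\in\mathrm{mod}\,\Lambda$. If $\Phi(\mathscr{C})$ is contravariantly finite in $\mathrm{mod}(\mathrm{mod}\,\Lambda)$, then $\mathscr{C}$ is contravariantly finite in $\mathrm{maps}(\mathrm{mod}\,\Lambda)$.
   Context: $\mathrm{mod}\,\Lambda$: finitely generated left $\Lambda$-modules. $\mathrm{mod}(\mathrm{mod}\,\Lambda)$: finitely presented contravariant functors from $\mathrm{mod}\,\Lambda$ to abelian groups; $(-,X)=\mathrm{Hom}_\Lambda(-,X)$. $\mathrm{maps}(\mathrm{mod}\,\Lambda)$: objects are triples $(A_1,A_0,f)$ with $f:A_1\to A_0$ a map of finitely generated $\Lambda$-modules; morphisms are commutative squares. Subcategories are full, additive (closed under finite direct sums), and closed under isomorphisms and direct summands; $\Phi(\mathscr{C})$ is the full subcategory of functors isomorphic to $\Phi(X)$ for some $X\in\mathscr{C}$. For a subcategory $\mathscr{X}$ of a category $\mathcal{B}$, a right $\mathscr{X}$-approximation of $M\in\mathcal{B}$ is a morphism $X\to M$ with $X\in\mathscr{X}$ through which every morphism $X'\to M$ with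 $X'\in\mathscr{X}$ factors. $\mathscr{X}$ is contravariantly finite in $\mathcal{B}$ if every object of $\mathcal{B}$ has a right $\mathscr{X}$-approximation. *)

theory Defs
  imports "HOL-Algebra.Ideal" "HOL-Algebra.Module"
begin

section \<open>Artin algebras and finitely generated left modules\<close>

definition finitely_generated_module :: "('a, 'c) ring_scheme \<Rightarrow> ('a, 'm, 'd) module_scheme \<Rightarrow> bool"
  where "finitely_generated_module R M \<longleftrightarrow>
    (\<exists>S. finite S \<and> S \<subseteq> carrier M \<and>
         (\<forall>N. submodule N R M \<and> S \<subseteq> N \<longrightarrow> N = carrier M))"

locale artinian_cring = cring R for R (structure) +
  assumes dcc: "\<lbrakk>\<And>n. ideal (I n) R; \<And>n. I (Suc n) \<subseteq> I n\<rbrakk> \<Longrightarrow>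
    \<exists>n. \<forall>k\<ge>n. I k = I (n::nat)"

text \<open>The locale \<^locale>\<open>algebra\<close> of the library only covers commutative algebras. As there, an
  \<open>R\<close>-algebra is a \<^type>\<open>module_ext\<close> record whose ring part is the multiplication of the
  algebra.\<close>

locale artin_algebra = R?: artinian_cring R + L?: module R L + L?: ring L
  for R (structure) and L (structure) +
  assumes smult_mult_left: "\<lbrakk>r \<in> carrier R; x \<in> carrier L; y \<in> carrier L\<rbrakk> \<Longrightarrow>
      (r \<odot>\<^bsub>L\<^esub> x) \<otimes>\<^bsub>L\<^esub> y = r \<odot>\<^bsub>L\<^esub> (x \<otimes>\<^bsub>L\<^esub> y)"
    and smult_mult_right: "\<lbrakk>r \<in> carrier R; x \<in> carrier L; y \<in> carrier L\<rbrakk> \<Longrightarrow>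
      x \<otimes>\<^bsub>L\<^esub> (r \<odot>\<^bsub>L\<^esub> y) = r \<odot>\<^bsub>L\<^esub> (x \<otimes>\<^bsub>L\<^esub> y)"
    and finitely_generated: "finitely_generated_module R L"

text \<open>Unital left modules over a ring that need not be commutative (the locale \<^locale>\<open>module\<close>
  assumes \<^const>\<open>cring\<close>). The ring multiplication and unit of the record \<open>M\<close> play no role.\<close>

locale left_module = L?: ring L + M?: abelian_group M
  for L :: "('a, 'c) ring_scheme" (structure) and M :: "('a, 'm, 'd) module_scheme" (structure) +
  assumes smult_closed [simp, intro]:
      "\<lbrakk>a \<in> carrier L; x \<in> carrier M\<rbrakk> \<Longrightarrow> a \<odot>\<^bsub>M\<^esub> x \<in> carrier M"
    and smult_l_distr:
      "\<lbrakk>a \<in> carrier L; b \<in> carrier L; x \<in> carrier M\<rbrakk> \<Longrightarrow>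
        (a \<oplus>\<^bsub>L\<^esub> b) \<odot>\<^bsub>M\<^esub> x = a \<odot>\<^bsub>M\<^esub> x \<oplus>\<^bsub>M\<^esub> b \<odot>\<^bsub>M\<^esub> x"
    and smult_r_distr:
      "\<lbrakk>a \<in> carrier L; x \<in> carrier M; y \<in> carrier M\<rbrakk> \<Longrightarrow>
        a \<odot>\<^bsub>M\<^esub> (x \<oplus>\<^bsub>M\<^esub> y) = a \<odot>\<^bsub>M\<^esub> x \<oplus>\<^bsub>M\<^esub> a \<odot>\<^bsub>M\<^esub> y"
    and smult_assoc:
      "\<lbrakk>a \<in> carrier L; b \<in> carrier L; x \<in> carrier M\<rbrakk> \<Longrightarrow>
        (a \<otimes>\<^bsub>L\<^esub> b) \<odot>\<^bsub>M\<^esub> x = a \<odot>\<^bsub>M\<^esub> (b \<odot>\<^bsub>M\<^esub> x)"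
    and smult_one [simp]: "x \<in> carrier M \<Longrightarrow> \<one>\<^bsub>L\<^esub> \<odot>\<^bsub>M\<^esub> x = x"

definition fgmod :: "('a, 'c) ring_scheme \<Rightarrow> ('a, 'm) module set"
  where "fgmod L = {M. left_module L M \<and> finitely_generated_module L M}"

text \<open>The group of homomorphisms under pointwise addition. Homomorphisms are undefined outside the
  carrier, so that they are determined by their values on it. All groups of morphisms below
  are written multiplicatively, to have \<^const>\<open>FactGroup\<close> at hand.\<close>

definition mod_hom ::
    "('a, 'c) ring_scheme \<Rightarrow> ('a, 'm) module \<Rightarrow> ('a, 'n) module \<Rightarrow> ('m \<Rightarrow> 'n) monoid"
  where "mod_hom L M N =
    \<lparr>carrier = {f \<in> carrier M \<rightarrow>\<^sub>E carrier N.
        (\<forall>x\<in>carrier M. \<forall>y\<in>carrier M. f (x \<oplus>\<^bsub>M\<^esub> y) = f x \<oplus>\<^bsub>N\<^esub> f y) \<and>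
        (\<forall>a\<in>carrier L. \<forall>x\<in>carrier M. f (a \<odot>\<^bsub>M\<^esub> x) = a \<odot>\<^bsub>N\<^esub> f x)},
     monoid.mult = (\<lambda>f g. \<lambda>x\<in>carrier M. f x \<oplus>\<^bsub>N\<^esub> g x),
     one = (\<lambda>x\<in>carrier M. \<zero>\<^bsub>N\<^esub>)\<rparr>"


subsection \<open>A type that carries all finitely generated modules\<close>

text \<open>A category needs a fixed type for the elements of its modules. The next lemmas show that
  \<^typ>\<open>(nat \<Rightarrow> 'a) set\<close> is large enough for a ring over \<^typ>\<open>'a\<close>: every finitely generated
  module, over any type, is isomorphic to one over this type (\<open>fgmod_small\<close>). An element is
  represented by the set of its coordinate families with respect to a finite list of generators.\<close>

context left_module begin

lemma smult_l_null: "x \<in> carrier M \<Longrightarrow> \<zero>\<^bsub>L\<^esub> \<odot>\<^bsub>M\<^esub> x = \<zero>\<^bsub>M\<^esub>"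
  by (metis L.l_zero L.zero_closed M.add.r_cancel_one' smult_closed smult_l_distr)

lemma smult_r_null: "a \<in> carrier L \<Longrightarrow> a \<odot>\<^bsub>M\<^esub> \<zero>\<^bsub>M\<^esub> = \<zero>\<^bsub>M\<^esub>"
  by (metis M.l_zero M.zero_closed M.add.r_cancel_one' smult_closed smult_r_distr)

lemma smult_l_minus: "\<lbrakk>a \<in> carrier L; x \<in> carrier M\<rbrakk> \<Longrightarrow> \<ominus>\<^bsub>L\<^esub> a \<odot>\<^bsub>M\<^esub> x = \<ominus>\<^bsub>M\<^esub> (a \<odot>\<^bsub>M\<^esub> x)"
  by (metis L.a_inv_closed L.l_neg M.minus_equality smult_closed smult_l_distr smult_l_null)

lemma finsum_smult:
  "\<lbrakk>finite A; a \<in> carrier L; f \<in> A \<rightarrow> carrier M\<rbrakk> \<Longrightarrow>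
    a \<odot>\<^bsub>M\<^esub> (\<Oplus>\<^bsub>M\<^esub>i\<in>A. f i) = (\<Oplus>\<^bsub>M\<^esub>i\<in>A. a \<odot>\<^bsub>M\<^esub> f i)"
  by (induct set: finite) (simp_all add: Pi_def smult_r_distr smult_r_null)

lemma submoduleI:
  assumes "H \<subseteq> carrier M" "\<zero>\<^bsub>M\<^esub> \<in> H" "\<And>a b. \<lbrakk>a \<in> H; b \<in> H\<rbrakk> \<Longrightarrow> a \<oplus>\<^bsub>M\<^esub> b \<in> H"
    and sm: "\<And>a x. \<lbrakk>a \<in> carrier L; x \<in> H\<rbrakk> \<Longrightarrow> a \<odot>\<^bsub>M\<^esub> x \<in> H"
  shows "submodule H L M"
proof -
  have "\<ominus>\<^bsub>M\<^esub> x \<in> H" if "x \<in> H" for x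
    using sm[of "\<ominus>\<^bsub>L\<^esub> \<one>\<^bsub>L\<^esub>" x] smult_l_minus[of "\<one>\<^bsub>L\<^esub>" x] that assms(1) by auto
  then show ?thesis
    using assms by (intro submodule.intro subgroup.intro submodule_axioms.intro)
      (auto simp: a_inv_def)
qed

lemma fg_embed:
  assumes "finitely_generated_module L M"
  obtains \<phi> :: "'m \<Rightarrow> (nat \<Rightarrow> 'a) set" where "inj_on \<phi> (carrier M)"
proof -
  obtain S where S: "finite S" "S \<subseteq> carrier M"
    and gen: "\<And>N. submodule N L M \<Longrightarrow> S \<subseteq> N \<Longrightarrow> N = carrier M"
    using assms unfolding finitely_generated_module_def by (elim exE conjE) simp
  obtain xs where xs: "set xs = S" using finite_list[OF S(1)] by blast
  define n where "n = length xs"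
  define ev where "ev c = (\<Oplus>\<^bsub>M\<^esub>i\<in>{..<n}. c i \<odot>\<^bsub>M\<^esub> (xs ! i))" for c
  have xc: "xs ! i \<in> carrier M" if "i < n" for i
    using that xs S(2) n_def nth_mem by blast
  let ?P = "{..<n} \<rightarrow> carrier L"
  have tc: "(\<lambda>i. c i \<odot>\<^bsub>M\<^esub> (xs ! i)) \<in> {..<n} \<rightarrow> carrier M" if "c \<in> ?P" for c
    using that xc by auto
  have "submodule (ev ` ?P) L M"
  proof (rule submoduleI)
    show "ev ` ?P \<subseteq> carrier M" unfolding ev_def using tc by auto
    have "ev (\<lambda>_. \<zero>\<^bsub>L\<^esub>) = \<zero>\<^bsub>M\<^esub>" unfolding ev_def
      using xc by (intro M.add.finprod_one_eqI) (auto simp: smult_l_null)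
    then show "\<zero>\<^bsub>M\<^esub> \<in> ev ` ?P"
      by (intro image_eqI[where x = "\<lambda>_. \<zero>\<^bsub>L\<^esub>"]) auto
  next
    fix a b assume "a \<in> ev ` ?P" "b \<in> ev ` ?P"
    then obtain c d where cd: "c \<in> ?P" "d \<in> ?P" "a = ev c" "b = ev d" by blast
    have "ev c \<oplus>\<^bsub>M\<^esub> ev d = (\<Oplus>\<^bsub>M\<^esub>i\<in>{..<n}. c i \<odot>\<^bsub>M\<^esub> (xs ! i) \<oplus>\<^bsub>M\<^esub> d i \<odot>\<^bsub>M\<^esub> (xs ! i))"
      unfolding ev_def by (subst M.finsum_addf[OF tc tc]) (use cd in auto)
    also have "\<dots> = ev (\<lambda>i. c i \<oplus>\<^bsub>L\<^esub> d i)" unfolding ev_def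
      by (rule M.finsum_cong') (use cd tc xc in \<open>auto simp: Pi_iff smult_l_distr\<close>)
    finally show "a \<oplus>\<^bsub>M\<^esub> b \<in> ev ` ?P" using cd by auto
  next
    fix a y assume a: "a \<in> carrier L" and "y \<in> ev ` ?P"
    then obtain c where c: "c \<in> ?P" "y = ev c" by blast
    have "a \<odot>\<^bsub>M\<^esub> ev c = (\<Oplus>\<^bsub>M\<^esub>i\<in>{..<n}. a \<odot>\<^bsub>M\<^esub> (c i \<odot>\<^bsub>M\<^esub> (xs ! i)))"
      unfolding ev_def by (rule finsum_smult[OF _ a tc[OF c(1)]]) simp
    also have "\<dots> = ev (\<lambda>i. a \<otimes>\<^bsub>L\<^esub> c i)" unfolding ev_def
      by (rule M.finsum_cong') (use c a xc in \<open>auto simp: Pi_iff smult_assoc\<close>)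
    finally show "a \<odot>\<^bsub>M\<^esub> y \<in> ev ` ?P" using c a by auto
  qed
  moreover have "S \<subseteq> ev ` ?P"
  proof
    fix s assume "s \<in> S"
    then obtain k where k: "k < n" "xs ! k = s" using xs n_def by (metis in_set_conv_nth)
    have "ev (\<lambda>i. if k = i then \<one>\<^bsub>L\<^esub> else \<zero>\<^bsub>L\<^esub>) =
        (\<Oplus>\<^bsub>M\<^esub>i\<in>{..<n}. if k = i then xs ! i else \<zero>\<^bsub>M\<^esub>)"
      unfolding ev_def
      by (rule M.finsum_cong') (use xc in \<open>auto simp: smult_l_null\<close>)
    also have "\<dots> = s" using M.finsum_singleton[of k "{..<n}" "\<lambda>i. xs ! i"] k xc by auto
    finally show "s \<in> ev ` ?P"
      by (intro image_eqI[where x = "\<lambda>i. if k = i then \<one>\<^bsub>L\<^esub> else \<zero>\<^bsub>L\<^esub>"]) auto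
  qed
  ultimately have surj: "ev ` ?P = carrier M" using gen by blast
  have "inj_on (\<lambda>x. {c \<in> ?P. ev c = x}) (carrier M)"
    unfolding inj_on_def surj[symmetric] by blast
  then show ?thesis using that by blast
qed

end

lemma left_module_transport:
  fixes M :: "('a, 'm) module"
  assumes "left_module L M" and inj: "inj_on \<phi> (carrier M)"
  obtains N :: "('a, 'n) module" where "left_module L N"
    and "carrier N = \<phi> ` carrier M" "restrict \<phi> (carrier M) \<in> carrier (mod_hom L M N)"
proof -
  interpret left_module L M by fact
  define \<psi> where "\<psi> = inv_into (carrier M) \<phi>"
  have [simp]: "\<psi> (\<phi> x) = x" if "x \<in> carrier M" for x
    unfolding \<psi>_def using inj that by simp
  define N :: "('a, 'n) module" where "N =
    \<lparr>carrier = \<phi> ` carrier M, monoid.mult = (\<lambda>u v. u), one = \<phi> \<zero>\<^bsub>M\<^esub>, zero = \<phi> \<zero>\<^bsub>M\<^esub>,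
     add = (\<lambda>u v. \<phi> (\<psi> u \<oplus>\<^bsub>M\<^esub> \<psi> v)), smult = (\<lambda>a u. \<phi> (a \<odot>\<^bsub>M\<^esub> \<psi> u))\<rparr>"
  have "abelian_group N"
  proof (rule abelian_groupI, goal_cases)
    case (6 x)
    then obtain y where "y \<in> carrier M" "x = \<phi> y" unfolding N_def by auto
    then have "\<phi> (\<ominus>\<^bsub>M\<^esub> y) \<in> carrier N" "\<phi> (\<ominus>\<^bsub>M\<^esub> y) \<oplus>\<^bsub>N\<^esub> x = \<zero>\<^bsub>N\<^esub>"
      unfolding N_def by (auto simp: M.l_neg)
    then show ?case by blast
  qed (auto simp: N_def M.a_ac)
  then have "left_module L N"
    by (intro left_module.intro left_module_axioms.intro)
       (auto simp: N_def smult_l_distr smult_r_distr smult_assoc intro: L.ring_axioms)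
  moreover have "restrict \<phi> (carrier M) \<in> carrier (mod_hom L M N)"
    unfolding mod_hom_def N_def by auto
  ultimately show ?thesis using that[of N] unfolding N_def by simp
qed

lemma fg_iso:
  fixes M :: "('a, 'm) module" and N :: "('a, 'n) module"
  assumes "left_module L M" "left_module L N" "f \<in> carrier (mod_hom L M N)"
    and surj: "f ` carrier M = carrier N" and fg: "finitely_generated_module L M"
  shows "finitely_generated_module L N"
proof -
  interpret M: left_module L M by fact
  interpret N: left_module L N by fact
  obtain S where S: "finite S" "S \<subseteq> carrier M"
    and gen: "\<And>N. submodule N L M \<Longrightarrow> S \<subseteq> N \<Longrightarrow> N = carrier M"
    using fg unfolding finitely_generated_module_def by (elim exE conjE) simp
  have f: "f x \<in> carrier N" "f (x \<oplus>\<^bsub>M\<^esub> y) = f x \<oplus>\<^bsub>N\<^esub> f y"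
      "a \<in> carrier L \<Longrightarrow> f (a \<odot>\<^bsub>M\<^esub> x) = a \<odot>\<^bsub>N\<^esub> f x"
    if "x \<in> carrier M" "y \<in> carrier M" for x y a
    using assms(3) that unfolding mod_hom_def by auto
  have f0: "f \<zero>\<^bsub>M\<^esub> = \<zero>\<^bsub>N\<^esub>"
    using f(1)[of "\<zero>\<^bsub>M\<^esub>" "\<zero>\<^bsub>M\<^esub>"] f(2)[of "\<zero>\<^bsub>M\<^esub>" "\<zero>\<^bsub>M\<^esub>"]
    by (simp add: N.M.add.r_cancel_one')
  have "H = carrier N" if H: "submodule H L N" "f ` S \<subseteq> H" for H
  proof -
    have H': "H \<subseteq> carrier N" "\<zero>\<^bsub>N\<^esub> \<in> H" "\<And>a b. a \<in> H \<Longrightarrow> b \<in> H \<Longrightarrow> a \<oplus>\<^bsub>N\<^esub> b \<in> H"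
      "\<And>a x. a \<in> carrier L \<Longrightarrow> x \<in> H \<Longrightarrow> a \<odot>\<^bsub>N\<^esub> x \<in> H"
      using submodule.axioms[OF H(1)] subgroup.subset[of H "add_monoid N"] subgroup.one_closed[of H "add_monoid N"]
       subgroup.m_closed[of H "add_monoid N"] submodule.smult_closed[OF H(1)] by auto
    have "submodule {x \<in> carrier M. f x \<in> H} L M"
      using f H' f0 by (intro M.submoduleI) auto
    then have "{x \<in> carrier M. f x \<in> H} = carrier M"
      using gen H(2) S(2) by blast
    then have "carrier N \<subseteq> H" unfolding surj[symmetric] by auto
    then show ?thesis using H'(1) by (rule subset_antisym[rotated])
  qed
  then show ?thesis unfolding finitely_generated_module_def
    using S f(1) by (intro exI[of _ "f ` S"]) auto
qed

lemma fgmod_small: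
  fixes M :: "('a, 'm) module"
  assumes "M \<in> fgmod L"
  obtains N :: "('a, (nat \<Rightarrow> 'a) set) module" and f
  where "N \<in> fgmod L" "f \<in> carrier (mod_hom L M N)" "bij_betw f (carrier M) (carrier N)"
proof -
  have M: "left_module L M" "finitely_generated_module L M" using assms by (auto simp: fgmod_def)
  obtain \<phi> :: "'m \<Rightarrow> (nat \<Rightarrow> 'a) set" where \<phi>: "inj_on \<phi> (carrier M)"
    by (rule left_module.fg_embed[OF M])
  obtain N :: "('a, (nat \<Rightarrow> 'a) set) module" where N: "left_module L N"
    "carrier N = \<phi> ` carrier M" "restrict \<phi> (carrier M) \<in> carrier (mod_hom L M N)"
    by (rule left_module_transport[OF M(1) \<phi>])
  show ?thesis
    by (rule that[of N "restrict \<phi> (carrier M)"])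
       (use N M \<phi> fg_iso[OF M(1) N(1,3)] in \<open>auto simp: fgmod_def bij_betw_def\<close>)
qed


section \<open>Approximations in preadditive categories\<close>

text \<open>\<open>Comp K A B C g f\<close> is the composite of \<open>f : A \<rightarrow> B\<close> and \<open>g : B \<rightarrow> C\<close>; the group operation
  of \<open>Hom K A B\<close> is the addition of morphisms.\<close>

record ('o, 'f) precat =
  Obj :: "'o set"
  Hom :: "'o \<Rightarrow> 'o \<Rightarrow> 'f monoid"
  Comp :: "'o \<Rightarrow> 'o \<Rightarrow> 'o \<Rightarrow> 'f \<Rightarrow> 'f \<Rightarrow> 'f"
  Ident :: "'o \<Rightarrow> 'f"

definition isomorphic_in :: "('o, 'f) precat \<Rightarrow> 'o \<Rightarrow> 'o \<Rightarrow> bool"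
  where "isomorphic_in K A B \<longleftrightarrow>
    (\<exists>f \<in> carrier (Hom K A B). \<exists>g \<in> carrier (Hom K B A).
       Comp K A B A g f = Ident K A \<and> Comp K B A B f g = Ident K B)"

definition zero_object :: "('o, 'f) precat \<Rightarrow> 'o \<Rightarrow> bool"
  where "zero_object K Z \<longleftrightarrow> Z \<in> Obj K \<and> Ident K Z = \<one>\<^bsub>Hom K Z Z\<^esub>"

definition direct_sum_in :: "('o, 'f) precat \<Rightarrow> 'o \<Rightarrow> 'o \<Rightarrow> 'o \<Rightarrow> bool"
  where "direct_sum_in K A B S \<longleftrightarrow>
    (\<exists>i \<in> carrier (Hom K A S). \<exists>j \<in> carrier (Hom K B S).
     \<exists>p \<in> carrier (Hom K S A). \<exists>q \<in> carrier (Hom K S B).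
       Comp K A S A p i = Ident K A \<and> Comp K B S B q j = Ident K B \<and>
       Comp K S A S i p \<otimes>\<^bsub>Hom K S S\<^esub> Comp K S B S j q = Ident K S)"

text \<open>Full subcategories are given by their sets of objects.\<close>

definition subcategory :: "('o, 'f) precat \<Rightarrow> 'o set \<Rightarrow> bool"
  where "subcategory K X \<longleftrightarrow> X \<subseteq> Obj K \<and>
    (\<forall>A\<in>X. \<forall>B\<in>Obj K. isomorphic_in K A B \<longrightarrow> B \<in> X) \<and>
    (\<forall>Z. zero_object K Z \<longrightarrow> Z \<in> X) \<and>
    (\<forall>A\<in>X. \<forall>B\<in>X. \<forall>S\<in>Obj K. direct_sum_in K A B S \<longrightarrow> S \<in> X) \<and>
    (\<forall>S\<in>X. \<forall>A\<in>Obj K. \<forall>B\<in>Obj K. direct_sum_in K A B S \<longrightarrow> A \<in> X \<and> B \<in> X)"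

definition right_approximation :: "('o, 'f) precat \<Rightarrow> 'o set \<Rightarrow> 'o \<Rightarrow> 'o \<Rightarrow> 'f \<Rightarrow> bool"
  where "right_approximation K X M A f \<longleftrightarrow> A \<in> X \<and> f \<in> carrier (Hom K A M) \<and>
    (\<forall>A'\<in>X. \<forall>g\<in>carrier (Hom K A' M). \<exists>h\<in>carrier (Hom K A' A). Comp K A' A M f h = g)"

definition contravariantly_finite :: "('o, 'f) precat \<Rightarrow> 'o set \<Rightarrow> bool"
  where "contravariantly_finite K X \<longleftrightarrow> (\<forall>M\<in>Obj K. \<exists>A f. right_approximation K X M A f)"


section \<open>The category of maps\<close>

type_synonym ('a, 'm) map_obj = "('a, 'm) module \<times> ('a, 'm) module \<times> ('m \<Rightarrow> 'm)"

fun maps_hom :: "('a, 'c) ring_scheme \<Rightarrow> ('a, 'm) map_obj \<Rightarrow> ('a, 'm) map_obj \<Rightarrow>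
    (('m \<Rightarrow> 'm) \<times> ('m \<Rightarrow> 'm)) monoid"
  where "maps_hom L (A1, A0, f) (B1, B0, g) =
    \<lparr>carrier = {(u1, u0). u1 \<in> carrier (mod_hom L A1 B1) \<and> u0 \<in> carrier (mod_hom L A0 B0) \<and>
        compose (carrier A1) g u1 = compose (carrier A1) u0 f},
     monoid.mult = (\<lambda>(u1, u0) (v1, v0). (u1 \<otimes>\<^bsub>mod_hom L A1 B1\<^esub> v1, u0 \<otimes>\<^bsub>mod_hom L A0 B0\<^esub> v0)),
     one = (\<one>\<^bsub>mod_hom L A1 B1\<^esub>, \<one>\<^bsub>mod_hom L A0 B0\<^esub>)\<rparr>"

definition maps_cat ::
    "('a, 'c) ring_scheme \<Rightarrow> (('a, 'm) map_obj, ('m \<Rightarrow> 'm) \<times> ('m \<Rightarrow> 'm)) precat"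
  where "maps_cat L =
    \<lparr>Obj = {(A1, A0, f). A1 \<in> fgmod L \<and> A0 \<in> fgmod L \<and> f \<in> carrier (mod_hom L A1 A0)},
     Hom = maps_hom L,
     Comp = (\<lambda>(A1, A0, _) _ _ (v1, v0) (u1, u0).
               (compose (carrier A1) v1 u1, compose (carrier A0) v0 u0)),
     Ident = (\<lambda>(A1, A0, _). (\<lambda>x\<in>carrier A1. x, \<lambda>x\<in>carrier A0. x))\<rparr>"


section \<open>Finitely presented contravariant functors\<close>

text \<open>For \<open>u : X \<rightarrow> Y\<close>, \<open>Farr F X Y u : F(Y) \<rightarrow> F(X)\<close> is the induced homomorphism.\<close>

record ('a, 'm, 'v) cfunctor =
  Fob :: "('a, 'm) module \<Rightarrow> 'v monoid"
  Farr :: "('a, 'm) module \<Rightarrow> ('a, 'm) module \<Rightarrow> ('m \<Rightarrow> 'm) \<Rightarrow> 'v \<Rightarrow> 'v"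

definition contravariant_functor :: "('a, 'c) ring_scheme \<Rightarrow> ('a, 'm, 'v) cfunctor \<Rightarrow> bool"
  where "contravariant_functor L F \<longleftrightarrow>
    (\<forall>X\<in>fgmod L. comm_group (Fob F X)) \<and>
    (\<forall>X\<in>fgmod L. \<forall>Y\<in>fgmod L. \<forall>u\<in>carrier (mod_hom L X Y).
       Farr F X Y u \<in> hom (Fob F Y) (Fob F X)) \<and>
    (\<forall>X\<in>fgmod L. \<forall>z\<in>carrier (Fob F X). Farr F X X (\<lambda>x\<in>carrier X. x) z = z) \<and>
    (\<forall>X\<in>fgmod L. \<forall>Y\<in>fgmod L. \<forall>Z\<in>fgmod L.
       \<forall>u\<in>carrier (mod_hom L X Y). \<forall>v\<in>carrier (mod_hom L Y Z). \<forall>z\<in>carrier (Fob F Z).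
         Farr F X Z (compose (carrier X) v u) z = Farr F X Y u (Farr F Y Z v z))"

text \<open>As for module homomorphisms, components are undefined outside the carriers, and families are
  undefined outside \<^term>\<open>fgmod L\<close>.\<close>

definition nat_trans ::
    "('a, 'c) ring_scheme \<Rightarrow> ('a, 'm, 'v) cfunctor \<Rightarrow> ('a, 'm, 'w) cfunctor \<Rightarrow>
      (('a, 'm) module \<Rightarrow> 'v \<Rightarrow> 'w) set"
  where "nat_trans L F G =
    {\<eta> \<in> (\<Pi>\<^sub>E X\<in>fgmod L. hom (Fob F X) (Fob G X) \<inter> extensional (carrier (Fob F X))).
       \<forall>X\<in>fgmod L. \<forall>Y\<in>fgmod L. \<forall>u\<in>carrier (mod_hom L X Y). \<forall>z\<in>carrier (Fob F Y).
         \<eta> X (Farr F X Y u z) = Farr G X Y u (\<eta> Y z)}"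

definition rep :: "('a, 'c) ring_scheme \<Rightarrow> ('a, 'm) module \<Rightarrow> ('a, 'm, 'm \<Rightarrow> 'm) cfunctor"
  where "rep L A =
    \<lparr>Fob = (\<lambda>X. mod_hom L X A), Farr = (\<lambda>X Y u h. compose (carrier X) h u)\<rparr>"

definition rep_map :: "('a, 'c) ring_scheme \<Rightarrow> ('a, 'm) module \<Rightarrow> ('m \<Rightarrow> 'm) \<Rightarrow>
    ('a, 'm) module \<Rightarrow> ('m \<Rightarrow> 'm) \<Rightarrow> ('m \<Rightarrow> 'm)"
  where "rep_map L A f =
    (\<lambda>X\<in>fgmod L. \<lambda>h\<in>carrier (mod_hom L X A). compose (carrier X) f h)"

text \<open>The pointwise cokernel of \<open>\<eta> : F \<rightarrow> G\<close>; its value on \<open>u : X \<rightarrow> Y\<close> sends the coset of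
  \<open>z \<in> G(Y)\<close> to the coset of \<open>G(u)(z)\<close>.\<close>

definition coker_functor :: "('a, 'm, 'v) cfunctor \<Rightarrow> ('a, 'm, 'w) cfunctor \<Rightarrow>
    (('a, 'm) module \<Rightarrow> 'v \<Rightarrow> 'w) \<Rightarrow> ('a, 'm, 'w set) cfunctor"
  where "coker_functor F G \<eta> =
    \<lparr>Fob = (\<lambda>X. Fob G X Mod (\<eta> X ` carrier (Fob F X))),
     Farr = (\<lambda>X Y u V. \<Union>z\<in>V. (\<eta> X ` carrier (Fob F X)) #>\<^bsub>Fob G X\<^esub> Farr G X Y u z)\<rparr>"

definition finitely_presented :: "('a, 'c) ring_scheme \<Rightarrow> ('a, 'm, 'v) cfunctor \<Rightarrow> bool"
  where "finitely_presented L F \<longleftrightarrow>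
    (\<exists>A1\<in>fgmod L. \<exists>A0\<in>fgmod L.
     \<exists>\<eta>\<in>nat_trans L (rep L A1) (rep L A0). \<exists>\<epsilon>\<in>nat_trans L (rep L A0) F.
     \<forall>X\<in>fgmod L.
       \<epsilon> X ` carrier (mod_hom L X A0) = carrier (Fob F X) \<and>
       kernel (mod_hom L X A0) (Fob F X) (\<epsilon> X) = \<eta> X ` carrier (mod_hom L X A1))"

text \<open>The category \<open>mod(mod \<Lambda>)\<close>. Functors take values in groups on \<^typ>\<open>('m \<Rightarrow> 'm) set\<close>,
  the type of the cokernels of maps between representable functors; up to isomorphism these
  are all the finitely presented functors.\<close>

definition modmod_cat :: "('a, 'c) ring_scheme \<Rightarrow>
    (('a, 'm, ('m \<Rightarrow> 'm) set) cfunctor,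
     ('a, 'm) module \<Rightarrow> ('m \<Rightarrow> 'm) set \<Rightarrow> ('m \<Rightarrow> 'm) set) precat"
  where "modmod_cat L =
    \<lparr>Obj = {F. contravariant_functor L F \<and> finitely_presented L F},
     Hom = (\<lambda>F G.
       \<lparr>carrier = nat_trans L F G,
        monoid.mult = (\<lambda>\<eta> \<theta>. \<lambda>X\<in>fgmod L. \<lambda>z\<in>carrier (Fob F X). \<eta> X z \<otimes>\<^bsub>Fob G X\<^esub> \<theta> X z),
        one = (\<lambda>X\<in>fgmod L. \<lambda>z\<in>carrier (Fob F X). \<one>\<^bsub>Fob G X\<^esub>)\<rparr>),
     Comp = (\<lambda>F _ _ \<theta> \<eta>. \<lambda>X\<in>fgmod L. compose (carrier (Fob F X)) (\<theta> X) (\<eta> X)),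
     Ident = (\<lambda>F. \<lambda>X\<in>fgmod L. \<lambda>z\<in>carrier (Fob F X). z)\<rparr>"

text \<open>\<open>\<Phi>\<close> on objects, which is all that its essential image depends on.\<close>

fun Phi :: "('a, 'c) ring_scheme \<Rightarrow> ('a, 'm) map_obj \<Rightarrow> ('a, 'm, ('m \<Rightarrow> 'm) set) cfunctor"
  where "Phi L (A1, A0, f) = coker_functor (rep L A1) (rep L A0) (rep_map L A1 f)"

definition Phi_image ::
    "('a, 'c) ring_scheme \<Rightarrow> ('a, 'm) map_obj set \<Rightarrow> ('a, 'm, ('m \<Rightarrow> 'm) set) cfunctor set"
  where "Phi_image L C =
    {F \<in> Obj (modmod_cat L). \<exists>A\<in>C. isomorphic_in (modmod_cat L) F (Phi L A)}"

end

theory Submission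
  imports Defs
begin

text \<open>
  Fix a map \<open>m : M\<^sub>1 \<rightarrow> M\<^sub>0\<close>. An approximation of \<open>\<Phi>(m)\<close> comes, up to isomorphism, from
  some \<open>C \<in> \<C>\<close>, and \<open>\<Phi>\<close> is full: by Yoneda a natural transformation between the cokernels is
  induced by a homomorphism between the targets, and the zero class of the structure map forces
  this homomorphism to extend to a commutative square (\<open>nat_trans_Phi_lift\<close>). So the approximation
  of \<open>\<Phi>(m)\<close> is induced by a morphism \<open>u : C \<rightarrow> m\<close>, and for each morphism \<open>v : D \<rightarrow> m\<close>
  with \<open>D \<in> \<C>\<close> there is \<open>w : D \<rightarrow> C\<close> such that \<open>v\<close> and \<open>u w\<close> have the same image under
  \<open>\<Phi>\<close>. On targets this equality of classes says \<open>v\<^sub>0 - u\<^sub>0 w\<^sub>0 = m \<sigma>\<close> for some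
  \<open>\<sigma> : D\<^sub>0 \<rightarrow> M\<^sub>1\<close> (\<open>Phi_approximation_lift\<close>).

  What remains of \<open>v\<close> is controlled by two further objects of \<open>\<C>\<close>. The square
  \<open>(\<sigma> d, m \<sigma>)\<close> factors through \<open>(1, m) : (M\<^sub>1 = M\<^sub>1) \<rightarrow> m\<close>. After subtracting it and
  \<open>u w\<close>, the square is \<open>(\<kappa>, 0)\<close>, so \<open>\<kappa>\<close> takes its values in \<open>K = Ker m\<close> and the square factors
  through \<open>(K \<rightarrow> 0) \<rightarrow> m\<close>. Hence
  \<open>C \<oplus> (M\<^sub>1 = M\<^sub>1) \<oplus> (K \<rightarrow> 0) \<rightarrow> m\<close> is a right \<open>\<C>\<close>-approximation
  (direct sums are supplied by \<open>maps_direct_sum\<close>).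

  For this \<open>K\<close> must be finitely generated, which is where the artin algebra enters: its ground ring
  is noetherian (\<open>artinian_imp_noetherian\<close>), so the algebra is noetherian as a module over the
  ground ring and therefore as a left module over itself, and then finitely generated modules have
  finitely generated submodules (\<open>finitely_generated_imp_noetherian\<close>).\<close>


section \<open>Finitely generated submodules\<close>

lemma fgmodD: "M \<in> fgmod L \<Longrightarrow> left_module L M" "M \<in> fgmod L \<Longrightarrow> finitely_generated_module L M"
  by (simp_all add: fgmod_def)

text \<open>Minimality among all submodules containing \<open>S\<close> replaces linear combinations, so that no finite
  sums of scalar multiples have to be formed.\<close>

definition generated_by :: "('a, 'c) ring_scheme \<Rightarrow> ('a, 'm, 'd) module_scheme \<Rightarrow> 'm set \<Rightarrow> 'm set \<Rightarrow> bool"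
  where "generated_by L M S N \<longleftrightarrow>
    S \<subseteq> N \<and> (\<forall>N'. submodule N' L M \<and> S \<subseteq> N' \<longrightarrow> N \<subseteq> N')"

definition fg_submodule :: "('a, 'c) ring_scheme \<Rightarrow> ('a, 'm, 'd) module_scheme \<Rightarrow> 'm set \<Rightarrow> bool"
  where "fg_submodule L M N \<longleftrightarrow> (\<exists>S. finite S \<and> generated_by L M S N)"

definition noetherian_module :: "('a, 'c) ring_scheme \<Rightarrow> ('a, 'm, 'd) module_scheme \<Rightarrow> bool"
  where "noetherian_module L M \<longleftrightarrow> (\<forall>N. submodule N L M \<longrightarrow> fg_submodule L M N)"

definition regular_module :: "('a, 'c) ring_scheme \<Rightarrow> ('a, 'a) module"
  where "regular_module L =
    \<lparr>carrier = carrier L, monoid.mult = (\<otimes>\<^bsub>L\<^esub>), one = \<one>\<^bsub>L\<^esub>, zero = \<zero>\<^bsub>L\<^esub>, add = (\<oplus>\<^bsub>L\<^esub>), smult = (\<otimes>\<^bsub>L\<^esub>)\<rparr>"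

lemma fg_submoduleI:
  assumes "finite S" "S \<subseteq> N" "\<And>N' x. \<lbrakk>submodule N' L M; S \<subseteq> N'; x \<in> N\<rbrakk> \<Longrightarrow> x \<in> N'"
  shows "fg_submodule L M N"
  using assms unfolding fg_submodule_def generated_by_def by blast

lemma generated_byD:
  assumes "generated_by L M S N"
  shows "S \<subseteq> N" and "\<lbrakk>submodule N' L M; S \<subseteq> N'\<rbrakk> \<Longrightarrow> N \<subseteq> N'"
  using assms unfolding generated_by_def by blast+

lemma regular_module_simps [simp]:
  "carrier (regular_module L) = carrier L" "\<zero>\<^bsub>regular_module L\<^esub> = \<zero>\<^bsub>L\<^esub>"
  "(\<oplus>\<^bsub>regular_module L\<^esub>) = (\<oplus>\<^bsub>L\<^esub>)" "(\<odot>\<^bsub>regular_module L\<^esub>) = (\<otimes>\<^bsub>L\<^esub>)"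
  by (simp_all add: regular_module_def)

lemma left_module_regular:
  assumes "ring L"
  shows "left_module L (regular_module L)"
proof -
  interpret L: ring L by fact
  have "abelian_group (regular_module L)"
    by (rule abelian_groupI) (auto simp: L.a_ac intro: L.l_neg)
  then show ?thesis
    by (intro left_module.intro left_module_axioms.intro assms)
      (auto simp: L.l_distr L.r_distr L.m_assoc)
qed

context left_module begin

lemma submoduleD:
  assumes "submodule N L M"
  shows "x \<in> N \<Longrightarrow> x \<in> carrier M"
    and "\<zero>\<^bsub>M\<^esub> \<in> N"
    and "\<lbrakk>x \<in> N; y \<in> N\<rbrakk> \<Longrightarrow> x \<oplus>\<^bsub>M\<^esub> y \<in> N"
    and "x \<in> N \<Longrightarrow> \<ominus>\<^bsub>M\<^esub> x \<in> N"
    and "\<lbrakk>a \<in> carrier L; x \<in> N\<rbrakk> \<Longrightarrow> a \<odot>\<^bsub>M\<^esub> x \<in> N"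
proof -
  interpret N: subgroup N "add_monoid M" using submodule.axioms(1)[OF assms] .
  show "x \<in> N \<Longrightarrow> x \<in> carrier M" using N.subset by auto
  show "\<zero>\<^bsub>M\<^esub> \<in> N" using N.one_closed by simp
  show "\<lbrakk>x \<in> N; y \<in> N\<rbrakk> \<Longrightarrow> x \<oplus>\<^bsub>M\<^esub> y \<in> N" using N.m_closed by simp
  show "x \<in> N \<Longrightarrow> \<ominus>\<^bsub>M\<^esub> x \<in> N" using N.m_inv_closed by (simp add: a_inv_def)
  show "\<lbrakk>a \<in> carrier L; x \<in> N\<rbrakk> \<Longrightarrow> a \<odot>\<^bsub>M\<^esub> x \<in> N" using submodule.smult_closed[OF assms] .
qed

lemma submodule_Int:
  assumes "submodule N L M" "submodule N' L M"
  shows "submodule (N \<inter> N') L M"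
  using submoduleD[OF assms(1)] submoduleD[OF assms(2)] by (intro submoduleI) auto

lemma submodule_smult_image_add:
  assumes "submodule N L M" "x \<in> carrier M"
  shows "submodule {a \<odot>\<^bsub>M\<^esub> x \<oplus>\<^bsub>M\<^esub> y | a y. a \<in> carrier L \<and> y \<in> N} L M"
    (is "submodule ?H L M")
proof (rule submoduleI)
  note N = submoduleD[OF assms(1)]
  show "?H \<subseteq> carrier M" using N assms(2) by auto
  show "\<zero>\<^bsub>M\<^esub> \<in> ?H" using N(2) assms(2)
    by (intro CollectI exI[of _ "\<zero>\<^bsub>L\<^esub>"] exI[of _ "\<zero>\<^bsub>M\<^esub>"]) (auto simp: smult_l_null)
next
  note N = submoduleD[OF assms(1)]
  fix u v assume "u \<in> ?H" "v \<in> ?H"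
  then obtain a y b z where h: "u = a \<odot>\<^bsub>M\<^esub> x \<oplus>\<^bsub>M\<^esub> y" "v = b \<odot>\<^bsub>M\<^esub> x \<oplus>\<^bsub>M\<^esub> z"
    "a \<in> carrier L" "b \<in> carrier L" "y \<in> N" "z \<in> N" by blast
  then have "u \<oplus>\<^bsub>M\<^esub> v = (a \<oplus>\<^bsub>L\<^esub> b) \<odot>\<^bsub>M\<^esub> x \<oplus>\<^bsub>M\<^esub> (y \<oplus>\<^bsub>M\<^esub> z)"
    using N(1) assms(2) by (simp add: smult_l_distr M.a_ac)
  then show "u \<oplus>\<^bsub>M\<^esub> v \<in> ?H" using h N(3) by blast
next
  note N = submoduleD[OF assms(1)]
  fix c u assume c: "c \<in> carrier L" and "u \<in> ?H"
  then obtain a y where h: "u = a \<odot>\<^bsub>M\<^esub> x \<oplus>\<^bsub>M\<^esub> y" "a \<in> carrier L" "y \<in> N" by blast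
  then have "c \<odot>\<^bsub>M\<^esub> u = (c \<otimes>\<^bsub>L\<^esub> a) \<odot>\<^bsub>M\<^esub> x \<oplus>\<^bsub>M\<^esub> c \<odot>\<^bsub>M\<^esub> y"
    using N(1) assms(2) c by (simp add: smult_r_distr smult_assoc)
  then show "c \<odot>\<^bsub>M\<^esub> u \<in> ?H" using h N(5) c by blast
qed

lemma submodule_zero: "submodule {\<zero>\<^bsub>M\<^esub>} L M"
  by (rule submoduleI) (auto simp: smult_r_null)

lemma submodule_Union_chain:
  assumes "\<N> \<noteq> {}" "\<And>N. N \<in> \<N> \<Longrightarrow> submodule N L M"
    and chain: "\<And>N N'. \<lbrakk>N \<in> \<N>; N' \<in> \<N>\<rbrakk> \<Longrightarrow> N \<subseteq> N' \<or> N' \<subseteq> N"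
  shows "submodule (\<Union>\<N>) L M"
proof -
  note * = submoduleD[OF assms(2)]
  show ?thesis
  proof (rule submoduleI)
    show "\<Union>\<N> \<subseteq> carrier M" using * by blast
    show "\<zero>\<^bsub>M\<^esub> \<in> \<Union>\<N>" using * assms(1) by blast
    show "a \<oplus>\<^bsub>M\<^esub> b \<in> \<Union>\<N>" if ab: "a \<in> \<Union>\<N>" "b \<in> \<Union>\<N>" for a b
    proof -
      obtain N N' where "N \<in> \<N>" "N' \<in> \<N>" "a \<in> N" "b \<in> N'" using ab by blast
      then show ?thesis using chain[of N N'] *(3)[of N a b] *(3)[of N' a b] by blast
    qed
    show "a \<odot>\<^bsub>M\<^esub> x \<in> \<Union>\<N>" if "a \<in> carrier L" "x \<in> \<Union>\<N>" for a x
      using that * by blast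
  qed
qed

text \<open>The scalars \<open>a\<close> with \<open>a x + y \<in> N\<close> for some \<open>y \<in> N\<^sub>0\<close> form a left ideal. Elements
  \<open>a x + y\<close> of \<open>N\<close> that lift generators of this ideal, together with generators of \<open>N \<inter> N\<^sub>0\<close>, generate \<open>N\<close>, as in the proof of
  the Hilbert basis theorem.\<close>

lemma fg_submodule_step:
  assumes noeth: "noetherian_module L (regular_module L)"
    and N0: "submodule N0 L M" and x: "x \<in> carrier M"
    and IH: "\<And>N. submodule N L M \<Longrightarrow> N \<subseteq> N0 \<Longrightarrow> fg_submodule L M N"
    and N: "submodule N L M" "N \<subseteq> {a \<odot>\<^bsub>M\<^esub> x \<oplus>\<^bsub>M\<^esub> y | a y. a \<in> carrier L \<and> y \<in> N0}"
  shows "fg_submodule L M N"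
proof -
  note ND = submoduleD[OF N(1)] and N0D = submoduleD[OF N0]
  interpret reg: left_module L "regular_module L" by (rule left_module_regular[OF L.ring_axioms])
  define J where "J B = {a \<in> carrier L. \<exists>y \<in> N0. a \<odot>\<^bsub>M\<^esub> x \<oplus>\<^bsub>M\<^esub> y \<in> B}" for B
  have subJ: "submodule (J B) L (regular_module L)" if B: "submodule B L M" for B
  proof (rule reg.submoduleI, unfold regular_module_simps)
    note BD = submoduleD[OF B]
    show "J B \<subseteq> carrier L" by (auto simp: J_def)
    show "\<zero>\<^bsub>L\<^esub> \<in> J B" using BD(2) N0D(2) x by (auto simp: J_def smult_l_null intro!: bexI[of _ "\<zero>\<^bsub>M\<^esub>"])
    show "a \<oplus>\<^bsub>L\<^esub> b \<in> J B" if ab: "a \<in> J B" "b \<in> J B" for a b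
    proof -
      obtain y z where h: "y \<in> N0" "z \<in> N0" "a \<in> carrier L" "b \<in> carrier L"
        "a \<odot>\<^bsub>M\<^esub> x \<oplus>\<^bsub>M\<^esub> y \<in> B" "b \<odot>\<^bsub>M\<^esub> x \<oplus>\<^bsub>M\<^esub> z \<in> B" using ab by (auto simp: J_def)
      then have "(a \<oplus>\<^bsub>L\<^esub> b) \<odot>\<^bsub>M\<^esub> x \<oplus>\<^bsub>M\<^esub> (y \<oplus>\<^bsub>M\<^esub> z) =
         (a \<odot>\<^bsub>M\<^esub> x \<oplus>\<^bsub>M\<^esub> y) \<oplus>\<^bsub>M\<^esub> (b \<odot>\<^bsub>M\<^esub> x \<oplus>\<^bsub>M\<^esub> z)"
        using N0D(1) x by (simp add: smult_l_distr M.a_ac)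
      then have "(a \<oplus>\<^bsub>L\<^esub> b) \<odot>\<^bsub>M\<^esub> x \<oplus>\<^bsub>M\<^esub> (y \<oplus>\<^bsub>M\<^esub> z) \<in> B" using BD(3) h by simp
      then show ?thesis using h N0D(3) unfolding J_def by blast
    qed
    show "c \<otimes>\<^bsub>L\<^esub> a \<in> J B" if c: "c \<in> carrier L" and a: "a \<in> J B" for a c
    proof -
      obtain y where h: "y \<in> N0" "a \<in> carrier L" "a \<odot>\<^bsub>M\<^esub> x \<oplus>\<^bsub>M\<^esub> y \<in> B"
        using a by (auto simp: J_def)
      then have "(c \<otimes>\<^bsub>L\<^esub> a) \<odot>\<^bsub>M\<^esub> x \<oplus>\<^bsub>M\<^esub> c \<odot>\<^bsub>M\<^esub> y = c \<odot>\<^bsub>M\<^esub> (a \<odot>\<^bsub>M\<^esub> x \<oplus>\<^bsub>M\<^esub> y)"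
        using N0D(1) x c by (simp add: smult_r_distr smult_assoc)
      then have "(c \<otimes>\<^bsub>L\<^esub> a) \<odot>\<^bsub>M\<^esub> x \<oplus>\<^bsub>M\<^esub> c \<odot>\<^bsub>M\<^esub> y \<in> B" using BD(5) h c by simp
      then show ?thesis using h N0D(5) c unfolding J_def by blast
    qed
  qed
  obtain T where T: "finite T" "generated_by L (regular_module L) T (J N)"
    using noeth subJ[OF N(1)] unfolding noetherian_module_def fg_submodule_def by blast
  note T = T(1) generated_byD[OF T(2)]
  have "\<forall>a\<in>T. \<exists>n. n \<in> N \<and> (\<exists>y\<in>N0. n = a \<odot>\<^bsub>M\<^esub> x \<oplus>\<^bsub>M\<^esub> y)"
    using T(2) unfolding J_def by blast
  from bchoice[OF this] obtain g where
    g: "\<And>a. a \<in> T \<Longrightarrow> g a \<in> N" "\<And>a. a \<in> T \<Longrightarrow> \<exists>y\<in>N0. g a = a \<odot>\<^bsub>M\<^esub> x \<oplus>\<^bsub>M\<^esub> y"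
    by blast
  obtain S where S: "finite S" "generated_by L M S (N \<inter> N0)"
    using IH[OF submodule_Int[OF N(1) N0]] unfolding fg_submodule_def by blast
  note S = S(1) generated_byD[OF S(2)]
  show ?thesis
  proof (rule fg_submoduleI[of "S \<union> g ` T"])
    show "finite (S \<union> g ` T)" using S(1) T(1) by simp
    show "S \<union> g ` T \<subseteq> N" using S(2) g(1) by auto
  next
    fix N' n assume N': "submodule N' L M" "S \<union> g ` T \<subseteq> N'" and n: "n \<in> N"
    let ?B = "N \<inter> N'"
    have B: "submodule ?B L M" using submodule_Int[OF N(1) N'(1)] .
    note BD = submoduleD[OF B]
    have "T \<subseteq> J ?B"
    proof
      fix a assume a: "a \<in> T"
      then obtain y where "y \<in> N0" "g a = a \<odot>\<^bsub>M\<^esub> x \<oplus>\<^bsub>M\<^esub> y" using g(2) by blast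
      moreover have "g a \<in> ?B" using g(1) N'(2) a by blast
      moreover have "a \<in> carrier L" using a T(2) by (auto simp: J_def)
      ultimately show "a \<in> J ?B" by (auto simp: J_def)
    qed
    then have sub: "J N \<subseteq> J ?B" using T(3)[OF subJ[OF B]] by blast
    obtain a y where ay: "a \<in> carrier L" "y \<in> N0" "n = a \<odot>\<^bsub>M\<^esub> x \<oplus>\<^bsub>M\<^esub> y" using n N(2) by blast
    then have "a \<in> J ?B" using sub n by (auto simp: J_def)
    then obtain z where z: "z \<in> N0" "a \<odot>\<^bsub>M\<^esub> x \<oplus>\<^bsub>M\<^esub> z \<in> ?B" by (auto simp: J_def)
    let ?b = "a \<odot>\<^bsub>M\<^esub> x \<oplus>\<^bsub>M\<^esub> z"
    have cl: "a \<odot>\<^bsub>M\<^esub> x \<in> carrier M" "y \<in> carrier M" "z \<in> carrier M" using ay z N0D(1) x by auto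
    \<comment> \<open>Modulo \<open>N'\<close>, the element \<open>n\<close> may be replaced by \<open>y - z\<close>, which lies in \<open>N\<^sub>0\<close>.\<close>
    have e: "n = ?b \<oplus>\<^bsub>M\<^esub> (y \<oplus>\<^bsub>M\<^esub> \<ominus>\<^bsub>M\<^esub> z)"
    proof -
      have "?b \<oplus>\<^bsub>M\<^esub> (y \<oplus>\<^bsub>M\<^esub> \<ominus>\<^bsub>M\<^esub> z) = a \<odot>\<^bsub>M\<^esub> x \<oplus>\<^bsub>M\<^esub> (y \<oplus>\<^bsub>M\<^esub> (z \<oplus>\<^bsub>M\<^esub> \<ominus>\<^bsub>M\<^esub> z))"
        using cl by (simp add: M.a_ac)
      then show ?thesis using cl ay(3) by (simp add: M.r_neg)
    qed
    have d0: "y \<oplus>\<^bsub>M\<^esub> \<ominus>\<^bsub>M\<^esub> z \<in> N0" using ay z N0D by blast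
    have "y \<oplus>\<^bsub>M\<^esub> \<ominus>\<^bsub>M\<^esub> z = n \<oplus>\<^bsub>M\<^esub> \<ominus>\<^bsub>M\<^esub> ?b"
    proof -
      have "n \<oplus>\<^bsub>M\<^esub> \<ominus>\<^bsub>M\<^esub> ?b = (y \<oplus>\<^bsub>M\<^esub> \<ominus>\<^bsub>M\<^esub> z) \<oplus>\<^bsub>M\<^esub> (?b \<oplus>\<^bsub>M\<^esub> \<ominus>\<^bsub>M\<^esub> ?b)"
        using cl by (subst e) (simp only: M.a_ac M.add.m_closed M.a_inv_closed)
      then show ?thesis using cl by (simp add: M.r_neg)
    qed
    then have "y \<oplus>\<^bsub>M\<^esub> \<ominus>\<^bsub>M\<^esub> z \<in> N" using n z ND by auto
    then have "y \<oplus>\<^bsub>M\<^esub> \<ominus>\<^bsub>M\<^esub> z \<in> N'" using d0 S(3)[OF N'(1)] N'(2) by blast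
    then show "n \<in> N'" using e z submoduleD(3)[OF N'(1)] by auto
  qed
qed

text \<open>Adding one generator at a time builds a submodule \<open>N\<^sub>0\<close> that contains the generators and all
  of whose submodules are finitely generated.\<close>

theorem finitely_generated_imp_noetherian:
  assumes noeth: "noetherian_module L (regular_module L)" and fg: "finitely_generated_module L M"
  shows "noetherian_module L M"
proof -
  obtain S where S: "finite S" "S \<subseteq> carrier M"
    and gen: "\<And>N. submodule N L M \<Longrightarrow> S \<subseteq> N \<Longrightarrow> N = carrier M"
    using fg unfolding finitely_generated_module_def by (elim exE conjE) simp
  have "\<exists>N0. submodule N0 L M \<and> S \<subseteq> N0 \<and>
      (\<forall>N. submodule N L M \<and> N \<subseteq> N0 \<longrightarrow> fg_submodule L M N)"
    using S
  proof (induction rule: finite_induct)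
    case empty
    have "fg_submodule L M N" if "submodule N L M" "N \<subseteq> {\<zero>\<^bsub>M\<^esub>}" for N
      using that submoduleD(2) by (intro fg_submoduleI[of "{}"]) auto
    then show ?case using submodule_zero by blast
  next
    case (insert x S)
    then obtain N0 where N0: "submodule N0 L M" "S \<subseteq> N0"
      and IH: "\<And>N. submodule N L M \<Longrightarrow> N \<subseteq> N0 \<Longrightarrow> fg_submodule L M N" by auto
    have x: "x \<in> carrier M" using insert.prems by simp
    note N0D = submoduleD[OF N0(1)]
    let ?H = "{a \<odot>\<^bsub>M\<^esub> x \<oplus>\<^bsub>M\<^esub> y | a y. a \<in> carrier L \<and> y \<in> N0}"
    have "x = \<one>\<^bsub>L\<^esub> \<odot>\<^bsub>M\<^esub> x \<oplus>\<^bsub>M\<^esub> \<zero>\<^bsub>M\<^esub>" using x by simp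
    then have xH: "x \<in> ?H" using N0D(2) by blast
    have "y \<in> ?H" if "y \<in> N0" for y
    proof -
      have "y = \<zero>\<^bsub>L\<^esub> \<odot>\<^bsub>M\<^esub> x \<oplus>\<^bsub>M\<^esub> y" using x N0D(1)[OF that] by (simp add: smult_l_null)
      then show ?thesis using that by blast
    qed
    then show ?case
      using submodule_smult_image_add[OF N0(1) x] fg_submodule_step[OF noeth N0(1) x IH] xH N0(2)
      by (intro exI[of _ ?H]) blast
  qed
  then obtain N0 where "submodule N0 L M" "S \<subseteq> N0"
    and *: "\<And>N. submodule N L M \<Longrightarrow> N \<subseteq> N0 \<Longrightarrow> fg_submodule L M N" by blast
  moreover have "N0 = carrier M" using gen calculation(1,2) by blast
  ultimately show ?thesis using submoduleD(1) unfolding noetherian_module_def by (metis subsetI)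
qed

end


section \<open>Commutative artinian rings are noetherian\<close>

text \<open>There is no submodule that is minimal among those that are not finitely generated. On such a
  submodule \<open>N\<close> each scalar acts either as zero or bijectively, so \<open>N\<close> is a vector space over a
  residue field of the ring. A complement of a line in it is a proper submodule, hence finitely
  generated, and then so is \<open>N\<close>.\<close>

locale module_over_artinian = left_module R M + artinian_cring R
  for R (structure) and M :: "('a, 'm, 'd) module_scheme" (structure)
begin

lemma smult_left_commute:
  "\<lbrakk>a \<in> carrier R; b \<in> carrier R; x \<in> carrier M\<rbrakk> \<Longrightarrow> a \<odot>\<^bsub>M\<^esub> (b \<odot>\<^bsub>M\<^esub> x) = b \<odot>\<^bsub>M\<^esub> (a \<odot>\<^bsub>M\<^esub> x)"
  using smult_assoc[of a b x] smult_assoc[of b a x] m_comm[of a b] by simp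

text \<open>The chain of the ideals \<open>(r\<^sup>n)\<close> becomes stationary, so \<open>r\<^sup>n = s r\<^sup>n\<^sup>+\<^sup>1\<close> for
  some \<open>s\<close>; as every element of \<open>N\<close> has the form \<open>r\<^sup>n z\<close> with \<open>z \<in> N\<close>, this \<open>s\<close> inverts \<open>r\<close> on \<open>N\<close>.\<close>

lemma surjective_scalar_invertible:
  assumes r: "r \<in> carrier R" and N: "submodule N R M"
    and surj: "(\<lambda>x. r \<odot>\<^bsub>M\<^esub> x) ` N = N"
  obtains s where "s \<in> carrier R" "\<And>x. x \<in> N \<Longrightarrow> s \<odot>\<^bsub>M\<^esub> (r \<odot>\<^bsub>M\<^esub> x) = x"
proof -
  note ND = submoduleD[OF N]
  define I where "I n = PIdl (r [^] n)" for n :: nat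
  have I: "ideal (I n) R" for n unfolding I_def using r by (intro cgenideal_ideal) simp
  have Isub: "I (Suc n) \<subseteq> I n" for n
  proof -
    have "r [^] Suc n \<in> I n" unfolding I_def cgenideal_def using r by (auto simp: m_comm)
    then show ?thesis unfolding I_def[of "Suc n"] using I by (intro cgenideal_minimal) auto
  qed
  obtain n where n: "I (Suc n) = I n"
    using dcc[of I, OF I Isub] by (metis le_SucI order_refl)
  have "r [^] n \<in> I (Suc n)" unfolding n unfolding I_def using r by (intro cgenideal_self) simp
  then obtain s where s: "s \<in> carrier R" "r [^] n = s \<otimes> r [^] Suc n"
    unfolding I_def cgenideal_def by auto
  have pow: "\<exists>z\<in>N. x = r [^] k \<odot>\<^bsub>M\<^esub> z" if "x \<in> N" for x and k :: nat
    using that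
  proof (induction k arbitrary: x)
    case 0 then show ?case using ND(1) by (intro bexI[of _ x]) auto
  next
    case (Suc k)
    obtain z where z: "z \<in> N" "x = r [^] k \<odot>\<^bsub>M\<^esub> z" using Suc by blast
    obtain w where w: "w \<in> N" "z = r \<odot>\<^bsub>M\<^esub> w" using z(1) surj by blast
    have "x = r [^] Suc k \<odot>\<^bsub>M\<^esub> w" using z w r ND(1) by (simp add: smult_assoc)
    then show ?case using w by blast
  qed
  have "s \<odot>\<^bsub>M\<^esub> (r \<odot>\<^bsub>M\<^esub> x) = x" if x: "x \<in> N" for x
  proof -
    obtain z where z: "z \<in> N" "x = r [^] n \<odot>\<^bsub>M\<^esub> z" using pow[OF x] by blast
    have zc: "z \<in> carrier M" using z ND(1) by blast
    have "s \<odot>\<^bsub>M\<^esub> (r \<odot>\<^bsub>M\<^esub> x) = (s \<otimes> (r \<otimes> r [^] n)) \<odot>\<^bsub>M\<^esub> z"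
      using r s(1) zc by (simp add: z(2) smult_assoc)
    also have "r \<otimes> r [^] n = r [^] Suc n" using r by (simp add: m_comm)
    finally show ?thesis by (simp only: s(2)[symmetric] z(2)[symmetric])
  qed
  then show ?thesis by (rule that[OF s(1)])
qed

text \<open>If \<open>r N\<close> is neither \<open>N\<close> nor zero, then \<open>r N\<close> and the kernel of \<open>r\<close> on \<open>N\<close> are proper submodules,
  hence finitely generated, and \<open>N\<close> is an extension of the one by the other.\<close>

lemma fg_submodule_scalar_dichotomy:
  assumes r: "r \<in> carrier R" and N: "submodule N R M"
    and proper: "\<And>N'. \<lbrakk>submodule N' R M; N' \<subset> N\<rbrakk> \<Longrightarrow> fg_submodule R M N'"
    and nfg: "\<not> fg_submodule R M N"
    and nsurj: "(\<lambda>x. r \<odot>\<^bsub>M\<^esub> x) ` N \<noteq> N"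
  shows "\<forall>x\<in>N. r \<odot>\<^bsub>M\<^esub> x = \<zero>\<^bsub>M\<^esub>"
proof (rule ccontr)
  assume nz: "\<not> (\<forall>x\<in>N. r \<odot>\<^bsub>M\<^esub> x = \<zero>\<^bsub>M\<^esub>)"
  note ND = submoduleD[OF N]
  let ?r = "\<lambda>x. r \<odot>\<^bsub>M\<^esub> x"
  have img: "submodule (?r ` B) R M" if B: "submodule B R M" for B
  proof (rule submoduleI)
    note BD = submoduleD[OF B]
    show "?r ` B \<subseteq> carrier M" using BD r by auto
    show "\<zero>\<^bsub>M\<^esub> \<in> ?r ` B" using BD(2) smult_r_null[OF r] by (metis image_eqI)
    show "u \<oplus>\<^bsub>M\<^esub> v \<in> ?r ` B" if uv: "u \<in> ?r ` B" "v \<in> ?r ` B" for u v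
    proof -
      obtain x y where h: "x \<in> B" "y \<in> B" "u = ?r x" "v = ?r y" using uv by blast
      then have "u \<oplus>\<^bsub>M\<^esub> v = ?r (x \<oplus>\<^bsub>M\<^esub> y)" using BD(1) r by (simp add: smult_r_distr)
      then show ?thesis using BD(3) h by blast
    qed
    show "a \<odot>\<^bsub>M\<^esub> u \<in> ?r ` B" if a: "a \<in> carrier R" and u: "u \<in> ?r ` B" for a u
    proof -
      obtain x where h: "x \<in> B" "u = ?r x" using u by blast
      then have "a \<odot>\<^bsub>M\<^esub> u = ?r (a \<odot>\<^bsub>M\<^esub> x)"
        using BD(1) r a by (simp add: smult_left_commute)
      then show ?thesis using BD(5) h a by blast
    qed
  qed
  have "?r ` N \<subset> N" using nsurj ND(5)[OF r] by blast
  then obtain T where T: "finite T" "generated_by R M T (?r ` N)"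
    using proper[OF img[OF N]] unfolding fg_submodule_def by blast
  note T = T(1) generated_byD[OF T(2)]
  obtain S' where S': "finite S'" "S' \<subseteq> N" "T = ?r ` S'"
    using T(1,2) by (metis finite_subset_image)
  define K where "K = {x \<in> N. ?r x = \<zero>\<^bsub>M\<^esub>}"
  have Ksub: "submodule K R M"
  proof (rule submoduleI)
    show "a \<odot>\<^bsub>M\<^esub> x \<in> K" if "a \<in> carrier R" "x \<in> K" for a x
    proof -
      have "?r (a \<odot>\<^bsub>M\<^esub> x) = a \<odot>\<^bsub>M\<^esub> ?r x"
        using that r ND(1) by (intro smult_left_commute) (auto simp: K_def)
      then show ?thesis using that ND(5) by (simp add: K_def smult_r_null)
    qed
  qed (use ND r in \<open>auto simp: K_def smult_r_null smult_r_distr\<close>)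
  have "K \<subset> N" using nz by (auto simp: K_def)
  then obtain S where S: "finite S" "generated_by R M S K"
    using proper[OF Ksub] unfolding fg_submodule_def by blast
  note S = S(1) generated_byD[OF S(2)]
  have "fg_submodule R M N"
  proof (rule fg_submoduleI[of "S \<union> S'"])
    show "finite (S \<union> S')" "S \<union> S' \<subseteq> N" using S S' by (auto simp: K_def)
    fix N' x assume N': "submodule N' R M" "S \<union> S' \<subseteq> N'" and x: "x \<in> N"
    have B: "submodule (N \<inter> N') R M" using submodule_Int[OF N N'(1)] .
    have "T \<subseteq> ?r ` (N \<inter> N')" using S' N'(2) by blast
    then have "?r x \<in> ?r ` (N \<inter> N')" using T(3)[OF img[OF B]] x by blast
    then obtain y where y: "y \<in> N" "y \<in> N'" "?r x = ?r y" by blast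
    have c: "x \<in> carrier M" "y \<in> carrier M" using ND x y by auto
    have "?r (\<ominus>\<^bsub>M\<^esub> y) = \<ominus>\<^bsub>M\<^esub> ?r y"
      by (metis M.add.inv_closed M.minus_equality M.l_neg c(2) r smult_closed smult_r_distr smult_r_null)
    then have "?r (x \<oplus>\<^bsub>M\<^esub> \<ominus>\<^bsub>M\<^esub> y) = \<zero>\<^bsub>M\<^esub>" using c r y(3) by (simp add: smult_r_distr M.r_neg)
    then have "x \<oplus>\<^bsub>M\<^esub> \<ominus>\<^bsub>M\<^esub> y \<in> K" using ND(3,4) x y by (simp add: K_def)
    then have "x \<oplus>\<^bsub>M\<^esub> \<ominus>\<^bsub>M\<^esub> y \<in> N'" using S(3)[OF N'(1)] N'(2) by blast
    then have "(x \<oplus>\<^bsub>M\<^esub> \<ominus>\<^bsub>M\<^esub> y) \<oplus>\<^bsub>M\<^esub> y \<in> N'" using submoduleD(3)[OF N'(1)] y by blast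
    then show "x \<in> N'" using c by (simp add: M.a_assoc M.l_neg)
  qed
  then show False using nfg by blast
qed

text \<open>A submodule \<open>H\<close> that is maximal with \<open>x \<notin> H\<close> plays the role of a complement of the line spanned
  by \<open>x\<close>.\<close>

lemma fg_submodule_if_proper_fg:
  assumes N: "submodule N R M"
    and proper: "\<And>N'. \<lbrakk>submodule N' R M; N' \<subset> N\<rbrakk> \<Longrightarrow> fg_submodule R M N'"
  shows "fg_submodule R M N"
proof (rule ccontr)
  assume nfg: "\<not> fg_submodule R M N"
  note ND = submoduleD[OF N]
  have "fg_submodule R M {\<zero>\<^bsub>M\<^esub>}" using submoduleD(2) by (intro fg_submoduleI[of "{}"]) auto
  then have "N \<noteq> {\<zero>\<^bsub>M\<^esub>}" using nfg by auto
  then obtain x where x: "x \<in> N" "x \<noteq> \<zero>\<^bsub>M\<^esub>" using ND(2) by blast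
  define \<H> where "\<H> = {H. submodule H R M \<and> H \<subseteq> N \<and> x \<notin> H}"
  have "\<exists>H\<in>\<H>. \<forall>H'\<in>\<H>. H \<subseteq> H' \<longrightarrow> H' = H"
  proof (rule subset_Zorn_nonempty)
    show "\<H> \<noteq> {}" using submodule_zero ND(2) x by (auto simp: \<H>_def)
    fix \<C> assume C: "\<C> \<noteq> {}" "subset.chain \<H> \<C>"
    then have *: "\<C> \<subseteq> \<H>" "\<And>N N'. N \<in> \<C> \<Longrightarrow> N' \<in> \<C> \<Longrightarrow> N \<subseteq> N' \<or> N' \<subseteq> N"
      by (auto simp: subset_chain_def)
    have "submodule (\<Union>\<C>) R M" using *
      by (intro submodule_Union_chain C(1)) (auto simp: \<H>_def)
    then show "\<Union>\<C> \<in> \<H>" using *(1) by (auto simp: \<H>_def)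
  qed
  then obtain H where HH: "H \<in> \<H>" "\<forall>H'\<in>\<H>. H \<subseteq> H' \<longrightarrow> H' = H" by blast
  have H: "submodule H R M" "H \<subseteq> N" "x \<notin> H" using HH(1) by (simp_all add: \<H>_def)
  have Hmax: "H' = H" if "submodule H' R M" "H' \<subseteq> N" "x \<notin> H'" "H \<subseteq> H'" for H'
    using HH(2) that by (simp add: \<H>_def)
  note HD = submoduleD[OF H(1)]
  have "H \<subset> N" using H x by blast
  then obtain S where S: "finite S" "generated_by R M S H"
    using proper[OF H(1)] unfolding fg_submodule_def by blast
  note S = S(1) generated_byD[OF S(2)]
  have key: "\<exists>a\<in>carrier R. \<exists>h\<in>H. y = a \<odot>\<^bsub>M\<^esub> x \<oplus>\<^bsub>M\<^esub> h" if y: "y \<in> N" for y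
  proof (cases "y \<in> H")
    case True
    then have "y = \<zero> \<odot>\<^bsub>M\<^esub> x \<oplus>\<^bsub>M\<^esub> y" using HD(1) ND(1) x by (simp add: smult_l_null)
    then show ?thesis using True by blast
  next
    case False
    let ?H' = "{a \<odot>\<^bsub>M\<^esub> y \<oplus>\<^bsub>M\<^esub> h | a h. a \<in> carrier R \<and> h \<in> H}"
    have yc: "y \<in> carrier M" and xc: "x \<in> carrier M" using y x ND(1) by auto
    have "submodule ?H' R M" by (rule submodule_smult_image_add[OF H(1) yc])
    moreover have "?H' \<subseteq> N" using ND(3,5) H(2) y by blast
    moreover have "h \<in> ?H'" if "h \<in> H" for h
    proof -
      have "h = \<zero> \<odot>\<^bsub>M\<^esub> y \<oplus>\<^bsub>M\<^esub> h" using HD(1)[OF that] yc by (simp add: smult_l_null)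
      then show ?thesis using that by blast
    qed
    moreover have "y \<in> ?H'"
    proof -
      have "y = \<one> \<odot>\<^bsub>M\<^esub> y \<oplus>\<^bsub>M\<^esub> \<zero>\<^bsub>M\<^esub>" using yc by simp
      then show ?thesis using HD(2) by blast
    qed
    ultimately have "x \<in> ?H'" using Hmax[of ?H'] False by blast
    \<comment> \<open>By maximality of \<open>H\<close>, the element \<open>x\<close> lies in \<open>H + R y\<close>; the coefficient of \<open>y\<close> acts invertibly,
      so the relation can be solved for \<open>y\<close>.\<close>
    then obtain r h where rh: "r \<in> carrier R" "h \<in> H" "x = r \<odot>\<^bsub>M\<^esub> y \<oplus>\<^bsub>M\<^esub> h" by blast
    have hc: "h \<in> carrier M" using HD rh by blast
    have "r \<odot>\<^bsub>M\<^esub> y \<noteq> \<zero>\<^bsub>M\<^esub>" using rh H(3) hc by auto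
    then have "(\<lambda>x. r \<odot>\<^bsub>M\<^esub> x) ` N = N"
      using fg_submodule_scalar_dichotomy[OF rh(1) N proper nfg] y by blast
    then obtain s where s: "s \<in> carrier R" "\<And>x. x \<in> N \<Longrightarrow> s \<odot>\<^bsub>M\<^esub> (r \<odot>\<^bsub>M\<^esub> x) = x"
      using surjective_scalar_invertible[OF rh(1) N] by blast
    have "s \<odot>\<^bsub>M\<^esub> x = y \<oplus>\<^bsub>M\<^esub> s \<odot>\<^bsub>M\<^esub> h"
      using s(2)[OF y] rh hc yc s(1) by (simp add: smult_r_distr)
    then have "y = s \<odot>\<^bsub>M\<^esub> x \<oplus>\<^bsub>M\<^esub> \<ominus>\<^bsub>M\<^esub> (s \<odot>\<^bsub>M\<^esub> h)"
      using yc hc s(1) by (simp add: M.a_assoc M.r_neg)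
    then show ?thesis using HD(4,5) s(1) rh(2) by blast
  qed
  have "fg_submodule R M N"
  proof (rule fg_submoduleI[of "insert x S"])
    show "finite (insert x S)" "insert x S \<subseteq> N" using S H x by auto
    fix N' y assume N': "submodule N' R M" "insert x S \<subseteq> N'" and y: "y \<in> N"
    show "y \<in> N'"
      using key[OF y] S(3)[OF N'(1)] N' submoduleD(3,5)[OF N'(1)] by blast
  qed
  then show False using nfg by blast
qed

end

text \<open>If some ideal were not finitely generated, then by the preceding lemma there would be a strictly
  descending sequence of such ideals.\<close>

theorem artinian_imp_noetherian:
  assumes "artinian_cring R"
  shows "noetherian_module R (regular_module R)"
proof (rule ccontr)
  interpret artinian_cring R by fact
  interpret reg: left_module R "regular_module R" by (rule left_module_regular[OF ring_axioms])
  interpret module_over_artinian R "regular_module R" by unfold_locales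
  assume "\<not> ?thesis"
  then obtain N0 where N0: "submodule N0 R (regular_module R)" "\<not> fg_submodule R (regular_module R) N0"
    by (auto simp: noetherian_module_def)
  have ideal: "ideal N R" if "submodule N R (regular_module R)" for N
  proof (rule idealI)
    note D = reg.submoduleD[OF that]
    have minus: "\<ominus>\<^bsub>R\<^esub> x \<in> N" if "x \<in> N" for x
      using D(1)[OF that] D(5)[of "\<ominus>\<^bsub>R\<^esub> \<one>\<^bsub>R\<^esub>" x] that by (simp add: l_minus)
    have "N \<subseteq> carrier R" using D(1) by auto
    then show "subgroup N (add_monoid R)"
      using D(2,3) minus by (intro add.subgroupI) (auto simp flip: a_inv_def)
    show "x \<otimes>\<^bsub>R\<^esub> a \<in> N" "a \<otimes>\<^bsub>R\<^esub> x \<in> N" if "a \<in> N" "x \<in> carrier R" for a x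
      using D(1)[of a] D(5)[of x a] that m_comm[of a x] by simp_all
  qed (rule ring_axioms)
  define bad where "bad N \<longleftrightarrow> submodule N R (regular_module R) \<and> \<not> fg_submodule R (regular_module R) N" for N
  have "\<exists>f. \<forall>n. bad (f n) \<and> f (Suc n) \<subset> f n"
  proof (rule dependent_nat_choice)
    show "\<exists>N. bad N" using N0 bad_def by blast
    show "\<exists>y. bad y \<and> y \<subset> x" if "bad x" for x :: "'a set" and n :: nat
      using that fg_submodule_if_proper_fg unfolding bad_def by blast
  qed
  then obtain f where f: "\<And>n. bad (f n)" "\<And>n. f (Suc n) \<subset> f n" by blast
  have "\<exists>n. \<forall>k\<ge>n. f k = f n"
    using f ideal unfolding bad_def by (intro dcc) blast+
  then show False using f(2) by (metis le_SucI order_refl psubset_eq)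
qed


section \<open>Submodules over an artin algebra\<close>

text \<open>A left ideal is closed under the ground ring, which acts through the multiples of the unit; so it is
  an \<open>R\<close>-submodule of a finitely generated \<open>R\<close>-module, and generators over \<open>R\<close> also generate it as
  a left ideal.\<close>

lemma artin_algebra_noetherian:
  assumes "artin_algebra R \<Lambda>"
  shows "noetherian_module \<Lambda> (regular_module \<Lambda>)"
proof -
  interpret artin_algebra R \<Lambda> by fact
  interpret RL: left_module R \<Lambda>
    by unfold_locales (simp_all add: L.smult_l_distr L.smult_r_distr L.smult_assoc1)
  interpret reg: left_module \<Lambda> "regular_module \<Lambda>" by (rule left_module_regular[OF L.ring_axioms])
  have RL_noeth: "noetherian_module R \<Lambda>"
    by (rule RL.finitely_generated_imp_noetherian[OF artinian_imp_noetherian finitely_generated])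
      unfold_locales
  have R_sub: "submodule I R \<Lambda>" if I: "submodule I \<Lambda> (regular_module \<Lambda>)" for I
  proof (rule RL.submoduleI)
    note D = reg.submoduleD[OF I, simplified]
    show "I \<subseteq> carrier \<Lambda>" "\<zero>\<^bsub>\<Lambda>\<^esub> \<in> I" using D by auto
    show "a \<oplus>\<^bsub>\<Lambda>\<^esub> b \<in> I" if "a \<in> I" "b \<in> I" for a b using D(3) that .
    show "r \<odot>\<^bsub>\<Lambda>\<^esub> x \<in> I" if r: "r \<in> carrier R" and x: "x \<in> I" for r x
    proof -
      have "(r \<odot>\<^bsub>\<Lambda>\<^esub> \<one>\<^bsub>\<Lambda>\<^esub>) \<otimes>\<^bsub>\<Lambda>\<^esub> x = r \<odot>\<^bsub>\<Lambda>\<^esub> x"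
        using smult_mult_left[OF r] D(1)[OF x] by simp
      then show ?thesis using D(5)[of "r \<odot>\<^bsub>\<Lambda>\<^esub> \<one>\<^bsub>\<Lambda>\<^esub>" x] r x by simp
    qed
  qed
  show ?thesis unfolding noetherian_module_def
  proof (intro allI impI)
    fix I assume I: "submodule I \<Lambda> (regular_module \<Lambda>)"
    obtain S where S: "finite S" "generated_by R \<Lambda> S I"
      using RL_noeth R_sub[OF I] unfolding noetherian_module_def fg_submodule_def by blast
    show "fg_submodule \<Lambda> (regular_module \<Lambda>) I"
      by (rule fg_submoduleI[OF S(1) generated_byD(1)[OF S(2)]])
        (use generated_byD(2)[OF S(2) R_sub] in blast)
  qed
qed

lemma fgmod_submodule:
  assumes M: "M \<in> fgmod L" and noeth: "noetherian_module L (regular_module L)" and N: "submodule N L M"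
  shows "M\<lparr>carrier := N\<rparr> \<in> fgmod L"
proof -
  interpret left_module L M using M by (rule fgmodD)
  note D = submoduleD[OF N]
  let ?N = "M\<lparr>carrier := N\<rparr>"
  have "abelian_group ?N"
  proof (rule abelian_groupI, goal_cases)
    case (6 x)
    then show ?case using D(1,4) by (intro bexI[of _ "\<ominus>\<^bsub>M\<^esub> x"]) (auto simp: M.l_neg)
  qed (use D in \<open>auto simp: M.a_ac\<close>)
  then have N': "left_module L ?N"
    using D by (intro left_module.intro left_module_axioms.intro L.ring_axioms)
      (auto simp: smult_l_distr smult_r_distr smult_assoc)
  then interpret N: left_module L ?N .
  have "noetherian_module L M"
    by (rule finitely_generated_imp_noetherian[OF noeth fgmodD(2)[OF M]])
  then obtain S where S: "finite S" "generated_by L M S N"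
    using N unfolding noetherian_module_def fg_submodule_def by blast
  have "N' = carrier ?N" if N': "submodule N' L ?N" "S \<subseteq> N'" for N'
  proof -
    note E = N.submoduleD[OF N'(1), simplified]
    have "submodule N' L M" using E D(1) by (intro submoduleI) auto
    then show ?thesis using generated_byD(2)[OF S(2) _ N'(2)] E(1) by auto
  qed
  then have "finitely_generated_module L ?N"
    using S generated_byD(1)[OF S(2)] unfolding finitely_generated_module_def by auto
  then show ?thesis using N' by (simp add: fgmod_def)
qed


section \<open>Groups of module homomorphisms\<close>

lemma mod_homD:
  assumes "f \<in> carrier (mod_hom L M N)"
  shows "x \<in> carrier M \<Longrightarrow> f x \<in> carrier N"
    and "\<lbrakk>x \<in> carrier M; y \<in> carrier M\<rbrakk> \<Longrightarrow> f (x \<oplus>\<^bsub>M\<^esub> y) = f x \<oplus>\<^bsub>N\<^esub> f y"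
    and "\<lbrakk>a \<in> carrier L; x \<in> carrier M\<rbrakk> \<Longrightarrow> f (a \<odot>\<^bsub>M\<^esub> x) = a \<odot>\<^bsub>N\<^esub> f x"
    and "f \<in> extensional (carrier M)"
  using assms by (auto simp: mod_hom_def PiE_def)

lemma mod_homI:
  assumes "left_module L M"
    and "\<And>x. x \<in> carrier M \<Longrightarrow> e x \<in> carrier N"
    and "\<And>x y. \<lbrakk>x \<in> carrier M; y \<in> carrier M\<rbrakk> \<Longrightarrow> e (x \<oplus>\<^bsub>M\<^esub> y) = e x \<oplus>\<^bsub>N\<^esub> e y"
    and "\<And>a x. \<lbrakk>a \<in> carrier L; x \<in> carrier M\<rbrakk> \<Longrightarrow> e (a \<odot>\<^bsub>M\<^esub> x) = a \<odot>\<^bsub>N\<^esub> e x"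
  shows "(\<lambda>x\<in>carrier M. e x) \<in> carrier (mod_hom L M N)"
proof -
  interpret left_module L M by fact
  show ?thesis using assms(2-) by (simp add: mod_hom_def)
qed

lemma mod_hom_zero:
  assumes "left_module L M" "left_module L N" "f \<in> carrier (mod_hom L M N)"
  shows "f \<zero>\<^bsub>M\<^esub> = \<zero>\<^bsub>N\<^esub>"
proof -
  interpret M: left_module L M by fact
  interpret N: left_module L N by fact
  have "f (\<zero>\<^bsub>L\<^esub> \<odot>\<^bsub>M\<^esub> \<zero>\<^bsub>M\<^esub>) = \<zero>\<^bsub>L\<^esub> \<odot>\<^bsub>N\<^esub> f \<zero>\<^bsub>M\<^esub>"
    by (rule mod_homD(3)[OF assms(3)]) auto
  then show ?thesis using mod_homD(1)[OF assms(3)] by (simp add: M.smult_l_null N.smult_l_null)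
qed

lemma mod_hom_uminus:
  assumes "left_module L M" "left_module L N" "f \<in> carrier (mod_hom L M N)" "x \<in> carrier M"
  shows "f (\<ominus>\<^bsub>M\<^esub> x) = \<ominus>\<^bsub>N\<^esub> f x"
proof -
  interpret M: left_module L M by fact
  interpret N: left_module L N by fact
  have "f (\<ominus>\<^bsub>M\<^esub> x) \<oplus>\<^bsub>N\<^esub> f x = \<zero>\<^bsub>N\<^esub>"
    using mod_homD(2)[OF assms(3), of "\<ominus>\<^bsub>M\<^esub> x" x] assms(4) mod_hom_zero[OF assms(1-3)]
    by (simp add: M.M.l_neg)
  then show ?thesis using mod_homD(1)[OF assms(3)] assms(4) by (simp add: N.M.minus_equality)
qed

lemma mod_hom_mult [simp]: "f \<otimes>\<^bsub>mod_hom L M N\<^esub> g = (\<lambda>x\<in>carrier M. f x \<oplus>\<^bsub>N\<^esub> g x)"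
  and mod_hom_one [simp]: "\<one>\<^bsub>mod_hom L M N\<^esub> = (\<lambda>x\<in>carrier M. \<zero>\<^bsub>N\<^esub>)"
  by (simp_all add: mod_hom_def)

lemma mod_hom_id: "left_module L M \<Longrightarrow> (\<lambda>x\<in>carrier M. x) \<in> carrier (mod_hom L M M)"
  by (rule mod_homI) auto

lemma mod_hom_const_zero:
  assumes "left_module L M" "left_module L N"
  shows "(\<lambda>x\<in>carrier M. \<zero>\<^bsub>N\<^esub>) \<in> carrier (mod_hom L M N)"
proof -
  interpret left_module L N by fact
  show ?thesis by (rule mod_homI[OF assms(1)]) (auto simp: smult_r_null)
qed

lemma mod_hom_compose:
  assumes "left_module L M" "f \<in> carrier (mod_hom L M N)" "g \<in> carrier (mod_hom L N P)"
  shows "compose (carrier M) g f \<in> carrier (mod_hom L M P)"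
  unfolding compose_def using mod_homD[OF assms(2)] mod_homD[OF assms(3)]
  by (intro mod_homI assms(1)) simp_all

lemma mod_hom_add:
  assumes "left_module L M" "left_module L N" "f \<in> carrier (mod_hom L M N)" "g \<in> carrier (mod_hom L M N)"
  shows "(\<lambda>x\<in>carrier M. f x \<oplus>\<^bsub>N\<^esub> g x) \<in> carrier (mod_hom L M N)"
proof -
  interpret N: left_module L N by fact
  show ?thesis
    using mod_homD[OF assms(3)] mod_homD[OF assms(4)]
    by (intro mod_homI assms(1)) (simp_all add: N.M.a_ac N.smult_r_distr)
qed

lemma mod_hom_neg:
  assumes "left_module L M" "left_module L N" "f \<in> carrier (mod_hom L M N)"
  shows "(\<lambda>x\<in>carrier M. \<ominus>\<^bsub>N\<^esub> f x) \<in> carrier (mod_hom L M N)"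
proof -
  interpret N: left_module L N by fact
  have "\<ominus>\<^bsub>N\<^esub> (a \<odot>\<^bsub>N\<^esub> y) = a \<odot>\<^bsub>N\<^esub> (\<ominus>\<^bsub>N\<^esub> y)" if "a \<in> carrier L" "y \<in> carrier N" for a y
  proof (rule N.M.minus_equality)
    have "a \<odot>\<^bsub>N\<^esub> (\<ominus>\<^bsub>N\<^esub> y) \<oplus>\<^bsub>N\<^esub> a \<odot>\<^bsub>N\<^esub> y = a \<odot>\<^bsub>N\<^esub> (\<ominus>\<^bsub>N\<^esub> y \<oplus>\<^bsub>N\<^esub> y)"
      using that by (simp add: N.smult_r_distr)
    then show "a \<odot>\<^bsub>N\<^esub> (\<ominus>\<^bsub>N\<^esub> y) \<oplus>\<^bsub>N\<^esub> a \<odot>\<^bsub>N\<^esub> y = \<zero>\<^bsub>N\<^esub>"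
      using that by (simp add: N.M.l_neg N.smult_r_null)
  qed (use that in auto)
  then show ?thesis
    using mod_homD[OF assms(3)]
    by (intro mod_homI assms(1)) (simp_all add: N.M.minus_add)
qed

lemma comm_group_mod_hom:
  assumes "left_module L M" "left_module L N"
  shows "comm_group (mod_hom L M N)"
proof (rule comm_groupI)
  interpret N: left_module L N by fact
  show "\<one>\<^bsub>mod_hom L M N\<^esub> \<in> carrier (mod_hom L M N)" using mod_hom_const_zero[OF assms] by simp
  fix f assume f: "f \<in> carrier (mod_hom L M N)"
  show "\<one>\<^bsub>mod_hom L M N\<^esub> \<otimes>\<^bsub>mod_hom L M N\<^esub> f = f"
    using mod_homD[OF f] by (auto intro!: extensionalityI[of _ "carrier M"])
  show "\<exists>g\<in>carrier (mod_hom L M N). g \<otimes>\<^bsub>mod_hom L M N\<^esub> f = \<one>\<^bsub>mod_hom L M N\<^esub>"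
    using mod_homD(1)[OF f]
    by (intro bexI[OF _ mod_hom_neg[OF assms f]]) (auto simp: N.M.l_neg intro!: restrict_ext)
  fix g assume g: "g \<in> carrier (mod_hom L M N)"
  show "f \<otimes>\<^bsub>mod_hom L M N\<^esub> g \<in> carrier (mod_hom L M N)" using mod_hom_add[OF assms f g] by simp
  show "f \<otimes>\<^bsub>mod_hom L M N\<^esub> g = g \<otimes>\<^bsub>mod_hom L M N\<^esub> f"
    using mod_homD(1)[OF f] mod_homD(1)[OF g] by (auto simp: N.M.a_comm intro!: restrict_ext)
  fix h assume h: "h \<in> carrier (mod_hom L M N)"
  show "f \<otimes>\<^bsub>mod_hom L M N\<^esub> g \<otimes>\<^bsub>mod_hom L M N\<^esub> h = f \<otimes>\<^bsub>mod_hom L M N\<^esub> (g \<otimes>\<^bsub>mod_hom L M N\<^esub> h)"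
    using mod_homD(1)[OF f] mod_homD(1)[OF g] mod_homD(1)[OF h]
    by (auto simp: N.M.a_assoc intro!: restrict_ext)
qed

lemma submodule_kernel:
  assumes "left_module L M" "left_module L N" "f \<in> carrier (mod_hom L M N)"
  shows "submodule {x \<in> carrier M. f x = \<zero>\<^bsub>N\<^esub>} L M"
proof -
  interpret M: left_module L M by fact
  interpret N: left_module L N by fact
  show ?thesis using mod_homD[OF assms(3)] mod_hom_zero[OF assms]
    by (intro M.submoduleI) (auto simp: N.smult_r_null)
qed


section \<open>The functors in the image of Phi\<close>

text \<open>The class of \<open>h\<close> in the cokernel of \<open>(X, A\<^sub>1) \<rightarrow> (X, A\<^sub>0)\<close>.\<close>

fun Phi_class :: "('a, 'c) ring_scheme \<Rightarrow> ('a, 'm) map_obj \<Rightarrow> ('a, 'm) module \<Rightarrow> ('m \<Rightarrow> 'm) \<Rightarrow> ('m \<Rightarrow> 'm) set"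
  where "Phi_class L (A1, A0, f) X h =
    (rep_map L A1 f X ` carrier (mod_hom L X A1)) #>\<^bsub>mod_hom L X A0\<^esub> h"

locale map_object =
  fixes L :: "('a, 'c) ring_scheme" and A1 A0 :: "('a, 'm) module" and f :: "'m \<Rightarrow> 'm"
  assumes object: "(A1, A0, f) \<in> Obj (maps_cat L)"
begin

lemma A1: "A1 \<in> fgmod L" and A0: "A0 \<in> fgmod L" and f: "f \<in> carrier (mod_hom L A1 A0)"
  using object by (auto simp: maps_cat_def)

sublocale A1: left_module L A1 using A1 by (rule fgmodD)
sublocale A0: left_module L A0 using A0 by (rule fgmodD)

abbreviation "A \<equiv> (A1, A0, f)"
abbreviation "boundaries X \<equiv> rep_map L A1 f X ` carrier (mod_hom L X A1)"

lemma rep_map_eq: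
  assumes "X \<in> fgmod L" "g \<in> carrier (mod_hom L X A1)"
  shows "rep_map L A1 f X g = compose (carrier X) f g"
  using assms by (simp add: rep_map_def)

lemma rep_map_hom:
  assumes X: "X \<in> fgmod L"
  shows "rep_map L A1 f X \<in> hom (mod_hom L X A1) (mod_hom L X A0)"
proof (rule homI)
  note X' = fgmodD(1)[OF X]
  fix g assume g: "g \<in> carrier (mod_hom L X A1)"
  show "rep_map L A1 f X g \<in> carrier (mod_hom L X A0)"
    using mod_hom_compose[OF X' g f] by (simp add: rep_map_eq[OF X g])
  fix h assume h: "h \<in> carrier (mod_hom L X A1)"
  have gh: "g \<otimes>\<^bsub>mod_hom L X A1\<^esub> h \<in> carrier (mod_hom L X A1)"
    using mod_hom_add[OF X' A1.left_module_axioms g h] by simp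
  show "rep_map L A1 f X (g \<otimes>\<^bsub>mod_hom L X A1\<^esub> h) =
      rep_map L A1 f X g \<otimes>\<^bsub>mod_hom L X A0\<^esub> rep_map L A1 f X h"
    unfolding rep_map_eq[OF X gh] rep_map_eq[OF X g] rep_map_eq[OF X h]
    using mod_homD(1)[OF g] mod_homD(1)[OF h] mod_homD(2)[OF f]
    by (auto simp: compose_def intro!: restrict_ext)
qed

lemma boundaries_subgroup:
  assumes X: "X \<in> fgmod L"
  shows "subgroup (boundaries X) (mod_hom L X A0)"
proof -
  interpret group_hom "mod_hom L X A1" "mod_hom L X A0" "rep_map L A1 f X"
    using comm_group_mod_hom[OF fgmodD(1)[OF X]] A1.left_module_axioms A0.left_module_axioms rep_map_hom[OF X]
    by (auto simp: group_hom_def group_hom_axioms_def comm_group_def)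
  show ?thesis by (rule img_is_subgroup)
qed

lemma hom_group: "X \<in> fgmod L \<Longrightarrow> comm_group (mod_hom L X A0)"
  using comm_group_mod_hom[OF fgmodD(1) A0.left_module_axioms] .

lemma Fob_Phi: "Fob (Phi L A) X = mod_hom L X A0 Mod boundaries X"
  by (simp add: coker_functor_def rep_def)

lemma carrier_Phi: "carrier (Fob (Phi L A) X) = Phi_class L A X ` carrier (mod_hom L X A0)"
  unfolding Fob_Phi carrier_FactGroup by simp

lemma comm_group_Phi: "X \<in> fgmod L \<Longrightarrow> comm_group (Fob (Phi L A) X)"
  unfolding Fob_Phi using comm_group.abelian_FactGroup[OF hom_group boundaries_subgroup] .

lemma mult_Phi:
  assumes X: "X \<in> fgmod L" and h: "h \<in> carrier (mod_hom L X A0)" and k: "k \<in> carrier (mod_hom L X A0)"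
  shows "Phi_class L A X h \<otimes>\<^bsub>Fob (Phi L A) X\<^esub> Phi_class L A X k =
    Phi_class L A X (\<lambda>x\<in>carrier X. h x \<oplus>\<^bsub>A0\<^esub> k x)"
proof -
  have "boundaries X \<lhd> mod_hom L X A0"
    by (rule comm_group.subgroup_imp_normal[OF hom_group[OF X] boundaries_subgroup[OF X]])
  from normal.rcos_sum[OF this h k] show ?thesis unfolding Fob_Phi by simp
qed

text \<open>The form in which equal classes are used: the difference of two representatives lifts along \<open>f\<close>.\<close>

lemma Phi_class_eq_iff:
  assumes X: "X \<in> fgmod L" and h: "h \<in> carrier (mod_hom L X A0)" and k: "k \<in> carrier (mod_hom L X A0)"
  shows "Phi_class L A X h = Phi_class L A X k \<longleftrightarrow>
    (\<exists>g\<in>carrier (mod_hom L X A1). \<forall>x\<in>carrier X. h x = f (g x) \<oplus>\<^bsub>A0\<^esub> k x)"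
proof -
  interpret G: comm_group "mod_hom L X A0" by (rule hom_group[OF X])
  have "Phi_class L A X h = Phi_class L A X k \<longleftrightarrow> h \<in> Phi_class L A X k"
    using G.repr_independence[OF _ k boundaries_subgroup[OF X], of h]
      G.rcos_self[OF h boundaries_subgroup[OF X]] by auto
  also have "\<dots> \<longleftrightarrow> (\<exists>g\<in>carrier (mod_hom L X A1). h = (\<lambda>x\<in>carrier X. f (g x) \<oplus>\<^bsub>A0\<^esub> k x))"
    by (auto simp: r_coset_def rep_map_eq[OF X] compose_def cong: restrict_cong)
  also have "\<dots> \<longleftrightarrow> (\<exists>g\<in>carrier (mod_hom L X A1). \<forall>x\<in>carrier X. h x = f (g x) \<oplus>\<^bsub>A0\<^esub> k x)"
    using mod_homD(4)[OF h] by (intro bex_cong refl) (auto intro!: extensionalityI[of _ "carrier X"])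
  finally show ?thesis .
qed

lemma mem_Phi_class:
  assumes X: "X \<in> fgmod L" and h: "h \<in> carrier (mod_hom L X A0)"
  shows "k \<in> Phi_class L A X h \<Longrightarrow> k \<in> carrier (mod_hom L X A0) \<and> Phi_class L A X k = Phi_class L A X h"
    and "h \<in> Phi_class L A X h"
proof -
  interpret G: comm_group "mod_hom L X A0" by (rule hom_group[OF X])
  show "k \<in> Phi_class L A X h \<Longrightarrow> k \<in> carrier (mod_hom L X A0) \<and> Phi_class L A X k = Phi_class L A X h"
    using G.repr_independence[OF _ h boundaries_subgroup[OF X], of k]
      G.r_coset_subset_G[OF subgroup.subset[OF boundaries_subgroup[OF X]] h] by auto
  show "h \<in> Phi_class L A X h" using G.rcos_self[OF h boundaries_subgroup[OF X]] by simp
qed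

text \<open>Functions on cosets are written as unions over representatives; this evaluates such a union once
  independence of the representative is known.\<close>

lemma UN_Phi_class:
  assumes X: "X \<in> fgmod L" and h: "h \<in> carrier (mod_hom L X A0)"
    and const: "\<And>k. \<lbrakk>k \<in> carrier (mod_hom L X A0); Phi_class L A X k = Phi_class L A X h\<rbrakk> \<Longrightarrow> \<psi> k = \<psi> h"
  shows "(\<Union>k\<in>Phi_class L A X h. \<psi> k) = \<psi> h"
proof -
  have "\<psi> k = \<psi> h" if "k \<in> Phi_class L A X h" for k
    using mem_Phi_class(1)[OF X h that] const by blast
  then show ?thesis using mem_Phi_class(2)[OF X h] by blast
qed

lemma Farr_Phi:
  assumes X: "X \<in> fgmod L" and Y: "Y \<in> fgmod L" and u: "u \<in> carrier (mod_hom L X Y)"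
    and h: "h \<in> carrier (mod_hom L Y A0)"
  shows "Farr (Phi L A) X Y u (Phi_class L A Y h) = Phi_class L A X (compose (carrier X) h u)"
proof -
  note X' = fgmodD(1)[OF X]
  have "Farr (Phi L A) X Y u (Phi_class L A Y h) =
      (\<Union>k\<in>Phi_class L A Y h. Phi_class L A X (compose (carrier X) k u))"
    by (simp add: coker_functor_def rep_def)
  also have "\<dots> = Phi_class L A X (compose (carrier X) h u)"
  proof (rule UN_Phi_class[OF Y h])
    fix k assume k: "k \<in> carrier (mod_hom L Y A0)" "Phi_class L A Y k = Phi_class L A Y h"
    then obtain g where g: "g \<in> carrier (mod_hom L Y A1)" "\<forall>x\<in>carrier Y. k x = f (g x) \<oplus>\<^bsub>A0\<^esub> h x"
      using Phi_class_eq_iff[OF Y _ h] by blast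
    show "Phi_class L A X (compose (carrier X) k u) = Phi_class L A X (compose (carrier X) h u)"
      using g mod_homD(1)[OF u] mod_hom_compose[OF X' u g(1)]
      by (subst Phi_class_eq_iff[OF X mod_hom_compose[OF X' u k(1)] mod_hom_compose[OF X' u h]])
        (auto simp: compose_def intro!: bexI[of _ "compose (carrier X) g u"])
  qed
  finally show ?thesis .
qed

lemma contravariant_functor_Phi: "contravariant_functor L (Phi L A)"
  unfolding contravariant_functor_def
proof (intro conjI ballI)
  fix X :: "('a, 'm) module" assume X: "X \<in> fgmod L"
  note X' = fgmodD(1)[OF X]
  show "comm_group (Fob (Phi L A) X)" using comm_group_Phi[OF X] .
  fix z assume "z \<in> carrier (Fob (Phi L A) X)"
  then obtain h where h: "h \<in> carrier (mod_hom L X A0)" "z = Phi_class L A X h"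
    unfolding carrier_Phi by blast
  have "compose (carrier X) h (\<lambda>x\<in>carrier X. x) = h"
    using mod_homD(4)[OF h(1)] by (auto simp: compose_def intro!: extensionalityI[of _ "carrier X"])
  then show "Farr (Phi L A) X X (\<lambda>x\<in>carrier X. x) z = z"
    using Farr_Phi[OF X X mod_hom_id[OF X'] h(1)] h(2) by simp
next
  fix X Y :: "('a, 'm) module" and u assume X: "X \<in> fgmod L" and Y: "Y \<in> fgmod L" and u: "u \<in> carrier (mod_hom L X Y)"
  note X' = fgmodD(1)[OF X] and Y' = fgmodD(1)[OF Y]
  show "Farr (Phi L A) X Y u \<in> hom (Fob (Phi L A) Y) (Fob (Phi L A) X)"
  proof (rule homI)
    fix V assume "V \<in> carrier (Fob (Phi L A) Y)"
    then obtain h where h: "h \<in> carrier (mod_hom L Y A0)" "V = Phi_class L A Y h"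
      unfolding carrier_Phi by blast
    show "Farr (Phi L A) X Y u V \<in> carrier (Fob (Phi L A) X)"
      using Farr_Phi[OF X Y u h(1)] mod_hom_compose[OF X' u h(1)] unfolding h(2) carrier_Phi by simp
    fix W assume "W \<in> carrier (Fob (Phi L A) Y)"
    then obtain k where k: "k \<in> carrier (mod_hom L Y A0)" "W = Phi_class L A Y k"
      unfolding carrier_Phi by blast
    have "compose (carrier X) (\<lambda>x\<in>carrier Y. h x \<oplus>\<^bsub>A0\<^esub> k x) u =
       (\<lambda>x\<in>carrier X. compose (carrier X) h u x \<oplus>\<^bsub>A0\<^esub> compose (carrier X) k u x)"
      using mod_homD(1)[OF u] by (auto simp: compose_def intro!: restrict_ext)
    then show "Farr (Phi L A) X Y u (V \<otimes>\<^bsub>Fob (Phi L A) Y\<^esub> W) =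
        Farr (Phi L A) X Y u V \<otimes>\<^bsub>Fob (Phi L A) X\<^esub> Farr (Phi L A) X Y u W"
      unfolding h(2) k(2) mult_Phi[OF Y h(1) k(1)] Farr_Phi[OF X Y u h(1)] Farr_Phi[OF X Y u k(1)]
        Farr_Phi[OF X Y u mod_hom_add[OF Y' A0.left_module_axioms h(1) k(1)]]
        mult_Phi[OF X mod_hom_compose[OF X' u h(1)] mod_hom_compose[OF X' u k(1)]]
      by simp
  qed
  fix Z :: "('a, 'm) module" and v z assume Z: "Z \<in> fgmod L" and v: "v \<in> carrier (mod_hom L Y Z)"
    and "z \<in> carrier (Fob (Phi L A) Z)"
  then obtain h where h: "h \<in> carrier (mod_hom L Z A0)" "z = Phi_class L A Z h"
    unfolding carrier_Phi by blast
  have "compose (carrier X) h (compose (carrier X) v u) = compose (carrier X) (compose (carrier Y) h v) u"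
    using mod_homD(1)[OF u] by (auto simp: compose_def intro!: restrict_ext)
  then show "Farr (Phi L A) X Z (compose (carrier X) v u) z = Farr (Phi L A) X Y u (Farr (Phi L A) Y Z v z)"
    unfolding h(2) Farr_Phi[OF Y Z v h(1)] Farr_Phi[OF X Y u mod_hom_compose[OF Y' v h(1)]]
      Farr_Phi[OF X Z mod_hom_compose[OF X' u v] h(1)] by simp
qed

lemma finitely_presented_Phi: "finitely_presented L (Phi L A)"
proof -
  define \<epsilon> where "\<epsilon> = (\<lambda>X\<in>fgmod L. \<lambda>h\<in>carrier (mod_hom L X A0). Phi_class L A X h)"
  have "rep_map L A1 f \<in> nat_trans L (rep L A1) (rep L A0)"
    unfolding nat_trans_def
  proof (intro CollectI conjI ballI)
    show "rep_map L A1 f \<in> (\<Pi>\<^sub>E X\<in>fgmod L. hom (Fob (rep L A1) X) (Fob (rep L A0) X) \<inter>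
        extensional (carrier (Fob (rep L A1) X)))"
      using rep_map_hom by (auto simp: rep_def rep_map_def PiE_def)
    fix X Y :: "('a, 'm) module" and u z assume X: "X \<in> fgmod L" and Y: "Y \<in> fgmod L" and u: "u \<in> carrier (mod_hom L X Y)"
      and z: "z \<in> carrier (Fob (rep L A1) Y)"
    then have z: "z \<in> carrier (mod_hom L Y A1)" by (simp add: rep_def)
    have "compose (carrier X) f (compose (carrier X) z u) = compose (carrier X) (compose (carrier Y) f z) u"
      using mod_homD(1)[OF u] by (auto simp: compose_def intro!: restrict_ext)
    then show "rep_map L A1 f X (Farr (rep L A1) X Y u z) = Farr (rep L A0) X Y u (rep_map L A1 f Y z)"
      using rep_map_eq[OF Y z] rep_map_eq[OF X mod_hom_compose[OF fgmodD(1)[OF X] u z]]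
      by (simp add: rep_def)
  qed
  moreover have "\<epsilon> \<in> nat_trans L (rep L A0) (Phi L A)"
    unfolding nat_trans_def
  proof (intro CollectI conjI ballI)
    show "\<epsilon> \<in> (\<Pi>\<^sub>E X\<in>fgmod L. hom (Fob (rep L A0) X) (Fob (Phi L A) X) \<inter>
        extensional (carrier (Fob (rep L A0) X)))"
    proof (rule PiE_I)
      fix X :: "('a, 'm) module" assume X: "X \<in> fgmod L"
      note add = mod_hom_add[OF fgmodD(1)[OF X] A0.left_module_axioms]
      have "\<epsilon> X \<in> hom (mod_hom L X A0) (Fob (Phi L A) X)"
        by (rule homI) (use X add in \<open>auto simp del: Phi.simps Phi_class.simps simp: \<epsilon>_def carrier_Phi mult_Phi\<close>)
      then show "\<epsilon> X \<in> hom (Fob (rep L A0) X) (Fob (Phi L A) X) \<inter> extensional (carrier (Fob (rep L A0) X))"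
        using X by (simp add: rep_def) (simp add: \<epsilon>_def)
    qed (simp add: \<epsilon>_def)
    fix X Y :: "('a, 'm) module" and u z assume X: "X \<in> fgmod L" and Y: "Y \<in> fgmod L" and u: "u \<in> carrier (mod_hom L X Y)"
      and z: "z \<in> carrier (Fob (rep L A0) Y)"
    then have z: "z \<in> carrier (mod_hom L Y A0)" by (simp add: rep_def)
    show "\<epsilon> X (Farr (rep L A0) X Y u z) = Farr (Phi L A) X Y u (\<epsilon> Y z)"
      using X Y z mod_hom_compose[OF fgmodD(1)[OF X] u z] Farr_Phi[OF X Y u z]
      by (simp add: rep_def \<epsilon>_def del: Phi.simps Phi_class.simps)
  qed
  moreover have "\<epsilon> X ` carrier (mod_hom L X A0) = carrier (Fob (Phi L A) X)" if "X \<in> fgmod L" for X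
    using that by (simp add: \<epsilon>_def carrier_Phi del: Phi.simps Phi_class.simps)
  moreover have "kernel (mod_hom L X A0) (Fob (Phi L A) X) (\<epsilon> X) = boundaries X" if X: "X \<in> fgmod L" for X
  proof -
    interpret G: comm_group "mod_hom L X A0" by (rule hom_group[OF X])
    have "h \<in> boundaries X \<longleftrightarrow> h \<in> carrier (mod_hom L X A0) \<and> boundaries X #>\<^bsub>mod_hom L X A0\<^esub> h = boundaries X" for h
      using G.coset_join1[OF _ _ boundaries_subgroup[OF X]] G.coset_join2[OF _ boundaries_subgroup[OF X]]
        subgroup.subset[OF boundaries_subgroup[OF X]] by blast
    then show ?thesis using X unfolding kernel_def Fob_Phi by (auto simp: \<epsilon>_def)
  qed
  ultimately show ?thesis unfolding finitely_presented_def using A1 A0 by blast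
qed

lemma Phi_object: "Phi L A \<in> Obj (modmod_cat L)"
  using contravariant_functor_Phi finitely_presented_Phi by (simp add: modmod_cat_def del: Phi.simps)

end


section \<open>Phi on morphisms\<close>

declare Phi.simps [simp del] Phi_class.simps [simp del]

lemma maps_homD:
  assumes "(v1, v0) \<in> carrier (maps_hom L (D1, D0, d) (M1, M0, m))"
  shows "v1 \<in> carrier (mod_hom L D1 M1)" and "v0 \<in> carrier (mod_hom L D0 M0)"
    and "x \<in> carrier D1 \<Longrightarrow> m (v1 x) = v0 (d x)"
proof -
  show "v1 \<in> carrier (mod_hom L D1 M1)" "v0 \<in> carrier (mod_hom L D0 M0)" using assms by simp_all
  have "compose (carrier D1) m v1 = compose (carrier D1) v0 d" using assms by simp
  then show "x \<in> carrier D1 \<Longrightarrow> m (v1 x) = v0 (d x)" by (metis compose_eq)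
qed

lemma maps_homI:
  assumes "v1 \<in> carrier (mod_hom L D1 M1)" "v0 \<in> carrier (mod_hom L D0 M0)"
    and "\<And>x. x \<in> carrier D1 \<Longrightarrow> m (v1 x) = v0 (d x)"
  shows "(v1, v0) \<in> carrier (maps_hom L (D1, D0, d) (M1, M0, m))"
  using assms by (auto simp: compose_def intro!: restrict_ext)

text \<open>The action of \<open>\<Phi>\<close> on morphisms, which sends the class of \<open>h\<close> to the class of \<open>v\<^sub>0 h\<close>. It is well
  defined because \<open>v\<^sub>0 (d g) = m (v\<^sub>1 g)\<close>.\<close>

fun Phi_map ::
    "('a, 'c) ring_scheme \<Rightarrow> ('a, 'm) map_obj \<Rightarrow> ('a, 'm) map_obj \<Rightarrow> ('m \<Rightarrow> 'm) \<times> ('m \<Rightarrow> 'm) \<Rightarrow>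
      ('a, 'm) module \<Rightarrow> ('m \<Rightarrow> 'm) set \<Rightarrow> ('m \<Rightarrow> 'm) set"
  where "Phi_map L (D1, D0, d) M (v1, v0) =
   (\<lambda>X\<in>fgmod L. \<lambda>V\<in>carrier (Fob (Phi L (D1, D0, d)) X).
      \<Union>h\<in>V. Phi_class L M X (compose (carrier X) v0 h))"

declare Phi_map.simps [simp del]

lemma Phi_map_class:
  assumes D: "(D1, D0, d) \<in> Obj (maps_cat L)" and M: "(M1, M0, m) \<in> Obj (maps_cat L)"
    and v: "(v1, v0) \<in> carrier (maps_hom L (D1, D0, d) (M1, M0, m))"
    and X: "X \<in> fgmod L" and h: "h \<in> carrier (mod_hom L X D0)"
  shows "Phi_map L (D1, D0, d) (M1, M0, m) (v1, v0) X (Phi_class L (D1, D0, d) X h) =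
    Phi_class L (M1, M0, m) X (compose (carrier X) v0 h)"
proof -
  interpret D: map_object L D1 D0 d by unfold_locales fact
  interpret M: map_object L M1 M0 m by unfold_locales fact
  note v = maps_homD[OF v] and X' = fgmodD(1)[OF X]
  have "(\<Union>k\<in>Phi_class L D.A X h. Phi_class L M.A X (compose (carrier X) v0 k)) =
      Phi_class L M.A X (compose (carrier X) v0 h)"
  proof (rule D.UN_Phi_class[OF X h])
    fix k assume k: "k \<in> carrier (mod_hom L X D0)" "Phi_class L D.A X k = Phi_class L D.A X h"
    then obtain g where g: "g \<in> carrier (mod_hom L X D1)" "\<forall>x\<in>carrier X. k x = d (g x) \<oplus>\<^bsub>D0\<^esub> h x"
      using D.Phi_class_eq_iff[OF X _ h] by blast
    have "compose (carrier X) v0 k x = m (compose (carrier X) v1 g x) \<oplus>\<^bsub>M0\<^esub> compose (carrier X) v0 h x"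
      if "x \<in> carrier X" for x
      using that g(2) mod_homD(1)[OF g(1)] mod_homD(1)[OF h] mod_homD(1)[OF D.f] mod_homD(2)[OF v(2)] v(3)
      by (simp add: compose_eq)
    then show "Phi_class L M.A X (compose (carrier X) v0 k) = Phi_class L M.A X (compose (carrier X) v0 h)"
      by (subst M.Phi_class_eq_iff[OF X mod_hom_compose[OF X' k(1) v(2)] mod_hom_compose[OF X' h v(2)]])
        (intro bexI[OF _ mod_hom_compose[OF X' g(1) v(1)]] ballI)
  qed
  then show ?thesis using X h by (simp add: Phi_map.simps D.carrier_Phi)
qed

lemma Phi_map_nat_trans:
  fixes L :: "('a, 'c) ring_scheme" and D1 D0 M1 M0 :: "('a, 'm) module"
  assumes D: "(D1, D0, d) \<in> Obj (maps_cat L)" and M: "(M1, M0, m) \<in> Obj (maps_cat L)"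
    and v: "(v1, v0) \<in> carrier (maps_hom L (D1, D0, d) (M1, M0, m))"
  shows "Phi_map L (D1, D0, d) (M1, M0, m) (v1, v0) \<in> nat_trans L (Phi L (D1, D0, d)) (Phi L (M1, M0, m))"
    (is "?\<eta> \<in> _")
proof -
  interpret D: map_object L D1 D0 d by unfold_locales fact
  interpret M: map_object L M1 M0 m by unfold_locales fact
  note \<eta> = Phi_map_class[OF D M v]
  note v = maps_homD[OF v]
  show ?thesis unfolding nat_trans_def
  proof (intro CollectI conjI ballI)
    show "?\<eta> \<in> (\<Pi>\<^sub>E X\<in>fgmod L. hom (Fob (Phi L D.A) X) (Fob (Phi L M.A) X) \<inter>
        extensional (carrier (Fob (Phi L D.A) X)))"
    proof (rule PiE_I)
      fix X :: "('a, 'm) module" assume X: "X \<in> fgmod L"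
      note X' = fgmodD(1)[OF X]
      have "?\<eta> X \<in> hom (Fob (Phi L D.A) X) (Fob (Phi L M.A) X)"
      proof (rule homI)
        fix V assume "V \<in> carrier (Fob (Phi L D.A) X)"
        then obtain h where h: "h \<in> carrier (mod_hom L X D0)" "V = Phi_class L D.A X h"
          unfolding D.carrier_Phi by blast
        note vh = mod_hom_compose[OF X' h(1) v(2)]
        show "?\<eta> X V \<in> carrier (Fob (Phi L M.A) X)"
          unfolding h(2) \<eta>[OF X h(1)] M.carrier_Phi using vh by blast
        fix W assume "W \<in> carrier (Fob (Phi L D.A) X)"
        then obtain k where k: "k \<in> carrier (mod_hom L X D0)" "W = Phi_class L D.A X k"
          unfolding D.carrier_Phi by blast
        note vk = mod_hom_compose[OF X' k(1) v(2)]
        have "compose (carrier X) v0 (\<lambda>x\<in>carrier X. h x \<oplus>\<^bsub>D0\<^esub> k x) =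
            (\<lambda>x\<in>carrier X. compose (carrier X) v0 h x \<oplus>\<^bsub>M0\<^esub> compose (carrier X) v0 k x)"
          using mod_homD(1)[OF h(1)] mod_homD(1)[OF k(1)] mod_homD(2)[OF v(2)]
          by (auto simp: compose_def intro!: restrict_ext)
        then show "?\<eta> X (V \<otimes>\<^bsub>Fob (Phi L D.A) X\<^esub> W) = ?\<eta> X V \<otimes>\<^bsub>Fob (Phi L M.A) X\<^esub> ?\<eta> X W"
          unfolding h(2) k(2) D.mult_Phi[OF X h(1) k(1)] \<eta>[OF X h(1)] \<eta>[OF X k(1)] M.mult_Phi[OF X vh vk]
            \<eta>[OF X mod_hom_add[OF X' D.A0.left_module_axioms h(1) k(1)]] by simp
      qed
      then show "?\<eta> X \<in> hom (Fob (Phi L D.A) X) (Fob (Phi L M.A) X) \<inter> extensional (carrier (Fob (Phi L D.A) X))"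
        using X by (simp add: Phi_map.simps)
    qed (simp add: Phi_map.simps)
    fix X Y :: "('a, 'm) module" and u z assume X: "X \<in> fgmod L" and Y: "Y \<in> fgmod L" and u: "u \<in> carrier (mod_hom L X Y)"
      and "z \<in> carrier (Fob (Phi L D.A) Y)"
    then obtain h where h: "h \<in> carrier (mod_hom L Y D0)" "z = Phi_class L D.A Y h"
      unfolding D.carrier_Phi by blast
    note X' = fgmodD(1)[OF X] and Y' = fgmodD(1)[OF Y]
    have "compose (carrier X) v0 (compose (carrier X) h u) = compose (carrier X) (compose (carrier Y) v0 h) u"
      using mod_homD(1)[OF u] by (auto simp: compose_def intro!: restrict_ext)
    then show "?\<eta> X (Farr (Phi L D.A) X Y u z) = Farr (Phi L M.A) X Y u (?\<eta> Y z)"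
      unfolding h(2) \<eta>[OF Y h(1)] D.Farr_Phi[OF X Y u h(1)] \<eta>[OF X mod_hom_compose[OF X' u h(1)]]
        M.Farr_Phi[OF X Y u mod_hom_compose[OF Y' h(1) v(2)]] by simp
  qed
qed

text \<open>Fullness of \<open>\<Phi>\<close>. As in the Yoneda lemma, \<open>w\<^sub>0\<close> is a representative of the image of the class of
  the identity of \<open>D\<^sub>0\<close>. The class of \<open>d\<close> at \<open>D\<^sub>1\<close> is zero, hence so is that of \<open>w\<^sub>0 d\<close>; that is,
  \<open>w\<^sub>0 d = c w\<^sub>1\<close> for some \<open>w\<^sub>1\<close>.\<close>

lemma nat_trans_Phi_lift:
  assumes D: "(D1, D0, d) \<in> Obj (maps_cat L)" and C: "(C1, C0, c) \<in> Obj (maps_cat L)"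
    and \<theta>: "\<theta> \<in> nat_trans L (Phi L (D1, D0, d)) (Phi L (C1, C0, c))"
  obtains w1 w0 where "(w1, w0) \<in> carrier (maps_hom L (D1, D0, d) (C1, C0, c))"
    "\<And>X h. \<lbrakk>X \<in> fgmod L; h \<in> carrier (mod_hom L X D0)\<rbrakk> \<Longrightarrow>
       \<theta> X (Phi_class L (D1, D0, d) X h) = Phi_class L (C1, C0, c) X (compose (carrier X) w0 h)"
proof -
  interpret D: map_object L D1 D0 d by unfold_locales fact
  interpret C: map_object L C1 C0 c by unfold_locales fact
  have \<theta>hom: "\<theta> X \<in> hom (Fob (Phi L D.A) X) (Fob (Phi L C.A) X)" if "X \<in> fgmod L" for X
    using \<theta> that by (auto simp: nat_trans_def PiE_def Pi_def)
  have \<theta>nat: "\<theta> X (Farr (Phi L D.A) X Y u z) = Farr (Phi L C.A) X Y u (\<theta> Y z)"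
    if "X \<in> fgmod L" "Y \<in> fgmod L" "u \<in> carrier (mod_hom L X Y)" "z \<in> carrier (Fob (Phi L D.A) Y)" for X Y u z
    using \<theta> that unfolding nat_trans_def by blast
  let ?id = "\<lambda>x\<in>carrier D0. x"
  have id: "?id \<in> carrier (mod_hom L D0 D0)" using mod_hom_id[OF D.A0.left_module_axioms] .
  have idc: "Phi_class L D.A D0 ?id \<in> carrier (Fob (Phi L D.A) D0)" unfolding D.carrier_Phi using id by blast
  then have "\<theta> D0 (Phi_class L D.A D0 ?id) \<in> carrier (Fob (Phi L C.A) D0)"
    using \<theta>hom[OF D.A0] by (rule hom_carrier[THEN subsetD, OF _ imageI, rotated])
  then obtain w0 where w0: "w0 \<in> carrier (mod_hom L D0 C0)"
      "\<theta> D0 (Phi_class L D.A D0 ?id) = Phi_class L C.A D0 w0"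
    unfolding C.carrier_Phi by blast
  have \<theta>eq: "\<theta> X (Phi_class L D.A X h) = Phi_class L C.A X (compose (carrier X) w0 h)"
    if X: "X \<in> fgmod L" and h: "h \<in> carrier (mod_hom L X D0)" for X h
  proof -
    have "compose (carrier X) ?id h = h"
      using mod_homD(1,4)[OF h] by (auto simp: compose_def intro!: extensionalityI[of _ "carrier X"])
    then have "\<theta> X (Phi_class L D.A X h) = \<theta> X (Farr (Phi L D.A) X D0 h (Phi_class L D.A D0 ?id))"
      using D.Farr_Phi[OF X D.A0 h id] by simp
    also have "\<dots> = Phi_class L C.A X (compose (carrier X) w0 h)"
      using \<theta>nat[OF X D.A0 h idc] C.Farr_Phi[OF X D.A0 h w0(1)] w0(2) by simp
    finally show ?thesis .
  qed
  \<comment> \<open>The class of \<open>d\<close> is zero, with witness the identity of \<open>D\<^sub>1\<close>.\<close>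
  let ?z = "\<lambda>x\<in>carrier D1. \<zero>\<^bsub>D0\<^esub>" and ?z' = "\<lambda>x\<in>carrier D1. \<zero>\<^bsub>C0\<^esub>"
  note D1' = D.A1.left_module_axioms
  have z: "?z \<in> carrier (mod_hom L D1 D0)" using mod_hom_const_zero[OF D1' D.A0.left_module_axioms] .
  have z': "?z' \<in> carrier (mod_hom L D1 C0)" using mod_hom_const_zero[OF D1' C.A0.left_module_axioms] .
  have "Phi_class L D.A D1 d = Phi_class L D.A D1 ?z"
    using mod_homD(1)[OF D.f]
    by (subst D.Phi_class_eq_iff[OF D.A1 D.f z]) (auto intro!: bexI[OF _ mod_hom_id[OF D1']])
  then have "Phi_class L C.A D1 (compose (carrier D1) w0 d) = Phi_class L C.A D1 (compose (carrier D1) w0 ?z)"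
    using \<theta>eq[OF D.A1 D.f] \<theta>eq[OF D.A1 z] by simp
  moreover have "compose (carrier D1) w0 ?z = ?z'"
    using mod_hom_zero[OF D.A0.left_module_axioms C.A0.left_module_axioms w0(1)]
    by (auto simp: compose_def intro!: restrict_ext)
  ultimately obtain w1 where w1: "w1 \<in> carrier (mod_hom L D1 C1)"
      "\<forall>x\<in>carrier D1. compose (carrier D1) w0 d x = c (w1 x) \<oplus>\<^bsub>C0\<^esub> ?z' x"
    using C.Phi_class_eq_iff[OF D.A1 mod_hom_compose[OF D1' D.f w0(1)] z'] by auto
  have "c (w1 x) = w0 (d x)" if "x \<in> carrier D1" for x
    using w1(2) that mod_homD(1)[OF w1(1) that] mod_homD(1)[OF C.f] by (simp add: compose_eq)
  then have "(w1, w0) \<in> carrier (maps_hom L D.A C.A)"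
    by (intro maps_homI w1(1) w0(1)) 
  then show ?thesis using \<theta>eq that by blast
qed

lemma nat_trans_compose:
  fixes L :: "('a, 'c) ring_scheme" and F :: "('a, 'm, 'v) cfunctor"
  assumes F: "contravariant_functor L F" and \<eta>: "\<eta> \<in> nat_trans L F G" and \<theta>: "\<theta> \<in> nat_trans L G H"
  shows "(\<lambda>X\<in>fgmod L. compose (carrier (Fob F X)) (\<theta> X) (\<eta> X)) \<in> nat_trans L F H" (is "?\<zeta> \<in> _")
proof -
  have h: "\<eta> X \<in> hom (Fob F X) (Fob G X)" "\<theta> X \<in> hom (Fob G X) (Fob H X)"
    "\<eta> X \<in> carrier (Fob F X) \<rightarrow> carrier (Fob G X)" if "X \<in> fgmod L" for X
    using \<eta> \<theta> that by (auto simp: nat_trans_def PiE_def Pi_def hom_def)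
  have comp: "?\<zeta> X = compose (carrier (Fob F X)) (\<theta> X) (\<eta> X)" if "X \<in> fgmod L" for X
    using that by simp
  show ?thesis unfolding nat_trans_def
  proof (intro CollectI conjI ballI PiE_I)
    fix X :: "('a, 'm) module" assume X: "X \<in> fgmod L"
    have "group (Fob F X)" using F X by (auto simp: contravariant_functor_def comm_group_def)
    then show "?\<zeta> X \<in> hom (Fob F X) (Fob H X) \<inter> extensional (carrier (Fob F X))"
      using group.hom_compose[OF _ h(1,2)[OF X]] unfolding comp[OF X]
      by (auto simp: hom_def compose_def Pi_def group_def monoid.m_closed)
  next
    fix X Y :: "('a, 'm) module" and u z assume X: "X \<in> fgmod L" and Y: "Y \<in> fgmod L" and u: "u \<in> carrier (mod_hom L X Y)"
      and z: "z \<in> carrier (Fob F Y)"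
    have "Farr F X Y u \<in> hom (Fob F Y) (Fob F X)"
      using F X Y u unfolding contravariant_functor_def by blast
    then have Fz: "Farr F X Y u z \<in> carrier (Fob F X)" using z by (auto simp: hom_def)
    have "\<eta> X (Farr F X Y u z) = Farr G X Y u (\<eta> Y z)"
      using \<eta> X Y u z unfolding nat_trans_def by blast
    moreover have "\<theta> X (Farr G X Y u (\<eta> Y z)) = Farr H X Y u (\<theta> Y (\<eta> Y z))"
      using \<theta> X Y u h(3)[OF Y] z unfolding nat_trans_def by blast
    ultimately show "?\<zeta> X (Farr F X Y u z) = Farr H X Y u (?\<zeta> Y z)"
      unfolding comp[OF X] comp[OF Y] using Fz z by (simp add: compose_eq)
  qed simp
qed


section \<open>Lifting approximations along Phi\<close>

lemma contravariant_functorD: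
  assumes "contravariant_functor L F"
  shows "X \<in> fgmod L \<Longrightarrow> comm_group (Fob F X)"
    and "\<lbrakk>X \<in> fgmod L; Y \<in> fgmod L; u \<in> carrier (mod_hom L X Y)\<rbrakk> \<Longrightarrow>
      Farr F X Y u \<in> hom (Fob F Y) (Fob F X)"
  using assms[unfolded contravariant_functor_def, THEN conjunct1]
    assms[unfolded contravariant_functor_def, THEN conjunct2, THEN conjunct1] by simp_all

lemma isomorphic_in_modmod_refl:
  assumes "F \<in> Obj (modmod_cat L)"
  shows "isomorphic_in (modmod_cat L) F F"
proof -
  let ?id = "\<lambda>X\<in>fgmod L. \<lambda>z\<in>carrier (Fob F X). z"
  have F: "contravariant_functor L F" using assms by (simp add: modmod_cat_def)
  have arr: "Farr F X Y u z \<in> carrier (Fob F X)"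
    if "X \<in> fgmod L" "Y \<in> fgmod L" "u \<in> carrier (mod_hom L X Y)" "z \<in> carrier (Fob F Y)" for X Y u z
    by (rule hom_in_carrier[OF contravariant_functorD(2)[OF F that(1-3)] that(4)])
  have grp: "group (Fob F X)" if "X \<in> fgmod L" for X
    using contravariant_functorD(1)[OF F that] by (simp add: comm_group_def)
  have "?id \<in> nat_trans L F F"
    using arr grp by (auto simp: nat_trans_def hom_def group_def monoid.m_closed)
  moreover have "(\<lambda>X\<in>fgmod L. compose (carrier (Fob F X)) (?id X) (?id X)) = ?id"
    by (auto simp: compose_def intro!: restrict_ext)
  ultimately show ?thesis unfolding isomorphic_in_def
    by (intro bexI[of _ ?id]) (simp_all add: modmod_cat_def)
qed

text \<open>Two squares into \<open>m\<close> that induce the same transformation differ on targets by a map that factors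
  through \<open>m\<close>; this is read off by evaluating at the class of the identity of \<open>D\<^sub>0\<close>.\<close>

lemma Phi_approximation_lift:
  fixes L :: "('a, 'c) ring_scheme" and M1 M0 :: "('a, 'm) module"
  assumes M: "(M1, M0, m) \<in> Obj (maps_cat L)" and \<C>: "\<C> \<subseteq> Obj (maps_cat L)"
    and approx: "right_approximation (modmod_cat L) (Phi_image L \<C>) (Phi L (M1, M0, m)) F \<eta>"
  obtains C1 C0 c u1 u0 where "(C1, C0, c) \<in> \<C>"
    "(u1, u0) \<in> carrier (maps_hom L (C1, C0, c) (M1, M0, m))"
    "\<forall>D1 D0 d v1 v0. (D1, D0, d) \<in> \<C> \<longrightarrow> (v1, v0) \<in> carrier (maps_hom L (D1, D0, d) (M1, M0, m)) \<longrightarrow>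
      (\<exists>w1 w0 s. (w1, w0) \<in> carrier (maps_hom L (D1, D0, d) (C1, C0, c)) \<and> s \<in> carrier (mod_hom L D0 M1) \<and>
        (\<forall>x\<in>carrier D0. v0 x = m (s x) \<oplus>\<^bsub>M0\<^esub> u0 (w0 x)))"
proof -
  interpret M: map_object L M1 M0 m by unfold_locales fact
  have F: "F \<in> Phi_image L \<C>" and \<eta>: "\<eta> \<in> nat_trans L F (Phi L M.A)"
    using approx by (simp_all add: right_approximation_def modmod_cat_def)
  have factor: "\<exists>\<theta>\<in>nat_trans L G F. (\<lambda>X\<in>fgmod L. compose (carrier (Fob G X)) (\<eta> X) (\<theta> X)) = \<phi>"
    if "G \<in> Phi_image L \<C>" "\<phi> \<in> nat_trans L G (Phi L M.A)" for G \<phi>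
    using approx that by (simp add: right_approximation_def modmod_cat_def)
  obtain C where C: "C \<in> \<C>" "isomorphic_in (modmod_cat L) F (Phi L C)"
    and Ffun: "contravariant_functor L F"
    using F by (auto simp: Phi_image_def modmod_cat_def)
  obtain C1 C0 c where C_eq: "C = (C1, C0, c)" by (cases C)
  have Cobj: "(C1, C0, c) \<in> Obj (maps_cat L)" using C(1) \<C> C_eq by blast
  interpret C: map_object L C1 C0 c by unfold_locales fact
  obtain \<alpha> \<beta> where \<alpha>: "\<alpha> \<in> nat_trans L F (Phi L C.A)" and \<beta>: "\<beta> \<in> nat_trans L (Phi L C.A) F"
    and \<beta>\<alpha>: "(\<lambda>X\<in>fgmod L. compose (carrier (Fob F X)) (\<beta> X) (\<alpha> X)) =
      (\<lambda>X\<in>fgmod L. \<lambda>z\<in>carrier (Fob F X). z)"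
    using C(2) unfolding isomorphic_in_def C_eq by (auto simp: modmod_cat_def)
  have \<beta>\<alpha>_eq: "\<beta> X (\<alpha> X z) = z" if "X \<in> fgmod L" "z \<in> carrier (Fob F X)" for X z
    using fun_cong[OF fun_cong[OF \<beta>\<alpha>, of X], of z] that by (simp add: compose_eq)
  note \<eta>\<beta> = nat_trans_compose[OF C.contravariant_functor_Phi \<beta> \<eta>]
  obtain u1 u0 where u: "(u1, u0) \<in> carrier (maps_hom L C.A M.A)"
    and u_eq: "\<And>X h. \<lbrakk>X \<in> fgmod L; h \<in> carrier (mod_hom L X C0)\<rbrakk> \<Longrightarrow>
       (\<lambda>X\<in>fgmod L. compose (carrier (Fob (Phi L C.A) X)) (\<eta> X) (\<beta> X)) X (Phi_class L C.A X h) =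
       Phi_class L M.A X (compose (carrier X) u0 h)"
    using nat_trans_Phi_lift[OF Cobj M \<eta>\<beta>] by blast
  have "\<exists>w1 w0 s. (w1, w0) \<in> carrier (maps_hom L (D1, D0, d) C.A) \<and> s \<in> carrier (mod_hom L D0 M1) \<and>
        (\<forall>x\<in>carrier D0. v0 x = m (s x) \<oplus>\<^bsub>M0\<^esub> u0 (w0 x))"
    if DC: "(D1, D0, d) \<in> \<C>" and v: "(v1, v0) \<in> carrier (maps_hom L (D1, D0, d) M.A)" for D1 D0 d v1 v0
  proof -
    have Dobj: "(D1, D0, d) \<in> Obj (maps_cat L)" using DC \<C> by blast
    interpret D: map_object L D1 D0 d by unfold_locales fact
    have "Phi L D.A \<in> Phi_image L \<C>"
      using D.Phi_object isomorphic_in_modmod_refl[OF D.Phi_object] DC by (auto simp: Phi_image_def)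
    from factor[OF this Phi_map_nat_trans[OF Dobj M v]]
    obtain \<theta> where \<theta>: "\<theta> \<in> nat_trans L (Phi L D.A) F"
      and \<eta>\<theta>: "(\<lambda>X\<in>fgmod L. compose (carrier (Fob (Phi L D.A) X)) (\<eta> X) (\<theta> X)) = Phi_map L D.A M.A (v1, v0)"
      by blast
    note \<alpha>\<theta> = nat_trans_compose[OF D.contravariant_functor_Phi \<theta> \<alpha>]
    obtain w1 w0 where w: "(w1, w0) \<in> carrier (maps_hom L D.A C.A)"
      and w_eq: "\<And>X h. \<lbrakk>X \<in> fgmod L; h \<in> carrier (mod_hom L X D0)\<rbrakk> \<Longrightarrow>
         (\<lambda>X\<in>fgmod L. compose (carrier (Fob (Phi L D.A) X)) (\<alpha> X) (\<theta> X)) X (Phi_class L D.A X h) =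
         Phi_class L C.A X (compose (carrier X) w0 h)"
      using nat_trans_Phi_lift[OF Dobj Cobj \<alpha>\<theta>] by blast
    note v' = maps_homD[OF v] and w' = maps_homD[OF w] and u' = maps_homD[OF u]
    let ?id = "\<lambda>x\<in>carrier D0. x"
    note D0' = D.A0.left_module_axioms
    have id: "?id \<in> carrier (mod_hom L D0 D0)" using mod_hom_id[OF D0'] .
    let ?z = "Phi_class L D.A D0 ?id"
    have z: "?z \<in> carrier (Fob (Phi L D.A) D0)" unfolding D.carrier_Phi using id by blast
    have "\<theta> D0 \<in> hom (Fob (Phi L D.A) D0) (Fob F D0)"
      using \<theta> D.A0 by (auto simp: nat_trans_def PiE_def Pi_def)
    then have \<theta>z: "\<theta> D0 ?z \<in> carrier (Fob F D0)" using z by (rule hom_in_carrier)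
    have comp_id: "compose (carrier D0) k ?id = k" if "k \<in> carrier (mod_hom L D0 N)" for k N
      using mod_homD(4)[OF that] by (auto simp: compose_def intro!: extensionalityI[of _ "carrier D0"])
    have "Phi_class L M.A D0 v0 = \<eta> D0 (\<theta> D0 ?z)"
      using Phi_map_class[OF Dobj M v D.A0 id] fun_cong[OF fun_cong[OF \<eta>\<theta>, of D0], of ?z] D.A0 z
      by (simp add: comp_id[OF v'(2)] compose_eq)
    also have "\<theta> D0 ?z = \<beta> D0 (\<alpha> D0 (\<theta> D0 ?z))" using \<beta>\<alpha>_eq[OF D.A0 \<theta>z] by simp
    also have "\<alpha> D0 (\<theta> D0 ?z) = Phi_class L C.A D0 w0"
      using w_eq[OF D.A0 id] D.A0 z by (simp add: comp_id[OF w'(2)] compose_eq)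
    also have "\<eta> D0 (\<beta> D0 (Phi_class L C.A D0 w0)) = Phi_class L M.A D0 (compose (carrier D0) u0 w0)"
    proof -
      have "Phi_class L C.A D0 w0 \<in> carrier (Fob (Phi L C.A) D0)" unfolding C.carrier_Phi using w'(2) by blast
      then show ?thesis using u_eq[OF D.A0 w'(2)] D.A0 by (simp add: compose_eq)
    qed
    finally obtain s where "s \<in> carrier (mod_hom L D0 M1)"
        "\<forall>x\<in>carrier D0. v0 x = m (s x) \<oplus>\<^bsub>M0\<^esub> compose (carrier D0) u0 w0 x"
      using M.Phi_class_eq_iff[OF D.A0 v'(2) mod_hom_compose[OF D0' w'(2) u'(2)]] by blast
    then show ?thesis using w by (intro exI[of _ w1] exI[of _ w0] exI[of _ s]) (simp add: compose_eq)
  qed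
  then show ?thesis by (intro that[OF C(1)[unfolded C_eq] u] allI impI)
qed


section \<open>Direct sums of modules and of maps\<close>

lemma inverse_mod_hom:
  assumes M: "left_module L M" and N: "left_module L N" and f: "f \<in> carrier (mod_hom L M N)"
    and bij: "bij_betw f (carrier M) (carrier N)"
  obtains g where "g \<in> carrier (mod_hom L N M)"
    "\<And>x. x \<in> carrier M \<Longrightarrow> g (f x) = x" "\<And>y. y \<in> carrier N \<Longrightarrow> f (g y) = y"
proof -
  interpret M: left_module L M by fact
  interpret N: left_module L N by fact
  let ?g = "inv_into (carrier M) f"
  have gf: "?g (f x) = x" if "x \<in> carrier M" for x
    using bij_betw_inv_into_left[OF bij that] .
  have fg: "f (?g y) = y" "?g y \<in> carrier M" if "y \<in> carrier N" for y
    using bij_betw_inv_into_right[OF bij that] bij_betw_apply[OF bij_betw_inv_into[OF bij] that] by auto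
  note f = mod_homD[OF f]
  have "(\<lambda>y\<in>carrier N. ?g y) \<in> carrier (mod_hom L N M)"
  proof (rule mod_homI[OF N])
    show "?g y \<in> carrier M" if "y \<in> carrier N" for y using fg that by blast
    show "?g (x \<oplus>\<^bsub>N\<^esub> y) = ?g x \<oplus>\<^bsub>M\<^esub> ?g y" if "x \<in> carrier N" "y \<in> carrier N" for x y
      using gf[of "?g x \<oplus>\<^bsub>M\<^esub> ?g y"] fg[OF that(1)] fg[OF that(2)] f(2) by simp
    show "?g (a \<odot>\<^bsub>N\<^esub> y) = a \<odot>\<^bsub>M\<^esub> ?g y" if "a \<in> carrier L" "y \<in> carrier N" for a y
      using gf[of "a \<odot>\<^bsub>M\<^esub> ?g y"] fg[OF that(2)] f(3) that(1) by simp
  qed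
  then show ?thesis by (rule that) (use gf fg f(1) in auto)
qed

definition product_module :: "('a, 'm) module \<Rightarrow> ('a, 'n) module \<Rightarrow> ('a, 'm \<times> 'n) module"
  where "product_module A B =
    \<lparr>carrier = carrier A \<times> carrier B, monoid.mult = (\<lambda>x y. x), one = (\<zero>\<^bsub>A\<^esub>, \<zero>\<^bsub>B\<^esub>),
     zero = (\<zero>\<^bsub>A\<^esub>, \<zero>\<^bsub>B\<^esub>), add = (\<lambda>x y. (fst x \<oplus>\<^bsub>A\<^esub> fst y, snd x \<oplus>\<^bsub>B\<^esub> snd y)),
     smult = (\<lambda>a x. (a \<odot>\<^bsub>A\<^esub> fst x, a \<odot>\<^bsub>B\<^esub> snd x))\<rparr>"

lemma product_module_simps [simp]:
  "carrier (product_module A B) = carrier A \<times> carrier B"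
  "\<zero>\<^bsub>product_module A B\<^esub> = (\<zero>\<^bsub>A\<^esub>, \<zero>\<^bsub>B\<^esub>)"
  "x \<oplus>\<^bsub>product_module A B\<^esub> y = (fst x \<oplus>\<^bsub>A\<^esub> fst y, snd x \<oplus>\<^bsub>B\<^esub> snd y)"
  "a \<odot>\<^bsub>product_module A B\<^esub> x = (a \<odot>\<^bsub>A\<^esub> fst x, a \<odot>\<^bsub>B\<^esub> snd x)"
  by (simp_all add: product_module_def)

text \<open>If a submodule of the product contains the generators placed in the two factors, then the elements
  of each factor that it contains form a submodule of that factor, which is everything.\<close>

lemma product_module_fgmod:
  assumes A: "A \<in> fgmod L" and B: "B \<in> fgmod L"
  shows "product_module A B \<in> fgmod L"
proof -
  interpret A: left_module L A using A by (rule fgmodD)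
  interpret B: left_module L B using B by (rule fgmodD)
  have "abelian_group (product_module A B)"
  proof (rule abelian_groupI, goal_cases)
    case (6 x)
    then show ?case
      by (intro bexI[of _ "(\<ominus>\<^bsub>A\<^esub> fst x, \<ominus>\<^bsub>B\<^esub> snd x)"]) (auto simp: A.M.l_neg B.M.l_neg)
  qed (auto simp: A.M.a_ac B.M.a_ac)
  then have P: "left_module L (product_module A B)"
    by (intro left_module.intro left_module_axioms.intro A.L.ring_axioms)
      (auto simp: A.smult_l_distr A.smult_r_distr A.smult_assoc B.smult_l_distr B.smult_r_distr B.smult_assoc)
  then interpret P: left_module L "product_module A B" .
  obtain S where S: "finite S" "S \<subseteq> carrier A" "\<And>N. submodule N L A \<Longrightarrow> S \<subseteq> N \<Longrightarrow> N = carrier A"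
    using fgmodD(2)[OF A] unfolding finitely_generated_module_def by (elim exE conjE) simp
  obtain T where T: "finite T" "T \<subseteq> carrier B" "\<And>N. submodule N L B \<Longrightarrow> T \<subseteq> N \<Longrightarrow> N = carrier B"
    using fgmodD(2)[OF B] unfolding finitely_generated_module_def by (elim exE conjE) simp
  let ?G = "(\<lambda>s. (s, \<zero>\<^bsub>B\<^esub>)) ` S \<union> Pair \<zero>\<^bsub>A\<^esub> ` T"
  have "N = carrier (product_module A B)" if N: "submodule N L (product_module A B)" "?G \<subseteq> N" for N
  proof -
    note D = P.submoduleD[OF N(1)]
    have "submodule {x \<in> carrier A. (x, \<zero>\<^bsub>B\<^esub>) \<in> N} L A"
    proof (rule A.submoduleI)
      show "a \<oplus>\<^bsub>A\<^esub> b \<in> {x \<in> carrier A. (x, \<zero>\<^bsub>B\<^esub>) \<in> N}"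
        if "a \<in> {x \<in> carrier A. (x, \<zero>\<^bsub>B\<^esub>) \<in> N}" "b \<in> {x \<in> carrier A. (x, \<zero>\<^bsub>B\<^esub>) \<in> N}" for a b
        using that D(3)[of "(a, \<zero>\<^bsub>B\<^esub>)" "(b, \<zero>\<^bsub>B\<^esub>)"] by simp
      show "r \<odot>\<^bsub>A\<^esub> a \<in> {x \<in> carrier A. (x, \<zero>\<^bsub>B\<^esub>) \<in> N}"
        if "r \<in> carrier L" "a \<in> {x \<in> carrier A. (x, \<zero>\<^bsub>B\<^esub>) \<in> N}" for r a
        using that D(5)[of r "(a, \<zero>\<^bsub>B\<^esub>)"] by (simp add: B.smult_r_null)
    qed (use D(2) in auto)
    then have a: "(x, \<zero>\<^bsub>B\<^esub>) \<in> N" if "x \<in> carrier A" for x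
      using S(2,3) N(2) that by blast
    have "submodule {x \<in> carrier B. (\<zero>\<^bsub>A\<^esub>, x) \<in> N} L B"
    proof (rule B.submoduleI)
      show "a \<oplus>\<^bsub>B\<^esub> b \<in> {x \<in> carrier B. (\<zero>\<^bsub>A\<^esub>, x) \<in> N}"
        if "a \<in> {x \<in> carrier B. (\<zero>\<^bsub>A\<^esub>, x) \<in> N}" "b \<in> {x \<in> carrier B. (\<zero>\<^bsub>A\<^esub>, x) \<in> N}" for a b
        using that D(3)[of "(\<zero>\<^bsub>A\<^esub>, a)" "(\<zero>\<^bsub>A\<^esub>, b)"] by simp
      show "r \<odot>\<^bsub>B\<^esub> a \<in> {x \<in> carrier B. (\<zero>\<^bsub>A\<^esub>, x) \<in> N}"
        if "r \<in> carrier L" "a \<in> {x \<in> carrier B. (\<zero>\<^bsub>A\<^esub>, x) \<in> N}" for r a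
        using that D(5)[of r "(\<zero>\<^bsub>A\<^esub>, a)"] by (simp add: A.smult_r_null)
    qed (use D(2) in auto)
    then have b: "(\<zero>\<^bsub>A\<^esub>, x) \<in> N" if "x \<in> carrier B" for x
      using T(2,3) N(2) that by blast
    have "(x, y) \<in> N" if "x \<in> carrier A" "y \<in> carrier B" for x y
      using D(3)[OF a[OF that(1)] b[OF that(2)]] that by simp
    then show ?thesis using D(1) by auto
  qed
  moreover have "finite ?G" "?G \<subseteq> carrier (product_module A B)" using S T by auto
  ultimately have "finitely_generated_module L (product_module A B)"
    unfolding finitely_generated_module_def by blast
  then show ?thesis using P by (simp add: fgmod_def)
qed

definition biproduct ::
    "('a, 'c) ring_scheme \<Rightarrow> ('a, 'm) module \<Rightarrow> ('a, 'n) module \<Rightarrow> ('a, 's) module \<Rightarrow>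
      ('m \<Rightarrow> 's) \<Rightarrow> ('n \<Rightarrow> 's) \<Rightarrow> ('s \<Rightarrow> 'm) \<Rightarrow> ('s \<Rightarrow> 'n) \<Rightarrow> bool"
  where "biproduct L A B S i j p q \<longleftrightarrow>
    i \<in> carrier (mod_hom L A S) \<and> j \<in> carrier (mod_hom L B S) \<and>
    p \<in> carrier (mod_hom L S A) \<and> q \<in> carrier (mod_hom L S B) \<and>
    (\<forall>x\<in>carrier A. p (i x) = x \<and> q (i x) = \<zero>\<^bsub>B\<^esub>) \<and>
    (\<forall>y\<in>carrier B. p (j y) = \<zero>\<^bsub>A\<^esub> \<and> q (j y) = y) \<and>
    (\<forall>s\<in>carrier S. i (p s) \<oplus>\<^bsub>S\<^esub> j (q s) = s)"

text \<open>The product lives on a type of pairs; its copy over the original type is transported along an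
  isomorphism.\<close>

lemma biproduct_exists:
  fixes A B :: "('a, (nat \<Rightarrow> 'a) set) module"
  assumes A: "A \<in> fgmod L" and B: "B \<in> fgmod L"
  obtains S :: "('a, (nat \<Rightarrow> 'a) set) module" and i j p q
  where "S \<in> fgmod L" "biproduct L A B S i j p q"
proof -
  let ?P = "product_module A B"
  interpret A: left_module L A using A by (rule fgmodD)
  interpret B: left_module L B using B by (rule fgmodD)
  have P: "?P \<in> fgmod L" by (rule product_module_fgmod[OF A B])
  obtain S :: "('a, (nat \<Rightarrow> 'a) set) module" and f where S: "S \<in> fgmod L"
    and f: "f \<in> carrier (mod_hom L ?P S)" "bij_betw f (carrier ?P) (carrier S)"
    using fgmod_small[OF P] by blast
  interpret S: left_module L S using S by (rule fgmodD)
  obtain g where g: "g \<in> carrier (mod_hom L S ?P)"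
    "\<And>x. x \<in> carrier ?P \<Longrightarrow> g (f x) = x" "\<And>y. y \<in> carrier S \<Longrightarrow> f (g y) = y"
    using inverse_mod_hom[OF fgmodD(1)[OF P] S.left_module_axioms f] by blast
  note fD = mod_homD[OF f(1)] and gD = mod_homD[OF g(1)]
  have gc: "fst (g s) \<in> carrier A" "snd (g s) \<in> carrier B" if "s \<in> carrier S" for s
    using gD(1)[OF that] by auto
  have "biproduct L A B S (\<lambda>x\<in>carrier A. f (x, \<zero>\<^bsub>B\<^esub>)) (\<lambda>y\<in>carrier B. f (\<zero>\<^bsub>A\<^esub>, y))
      (\<lambda>s\<in>carrier S. fst (g s)) (\<lambda>s\<in>carrier S. snd (g s))"
    unfolding biproduct_def
  proof (intro conjI ballI)
    show "(\<lambda>x\<in>carrier A. f (x, \<zero>\<^bsub>B\<^esub>)) \<in> carrier (mod_hom L A S)"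
    proof (rule mod_homI[OF A.left_module_axioms])
      show "f (x, \<zero>\<^bsub>B\<^esub>) \<in> carrier S" if "x \<in> carrier A" for x using fD(1) that by simp
      show "f (x \<oplus>\<^bsub>A\<^esub> y, \<zero>\<^bsub>B\<^esub>) = f (x, \<zero>\<^bsub>B\<^esub>) \<oplus>\<^bsub>S\<^esub> f (y, \<zero>\<^bsub>B\<^esub>)" if "x \<in> carrier A" "y \<in> carrier A" for x y
        using fD(2)[of "(x, \<zero>\<^bsub>B\<^esub>)" "(y, \<zero>\<^bsub>B\<^esub>)"] that by simp
      show "f (a \<odot>\<^bsub>A\<^esub> x, \<zero>\<^bsub>B\<^esub>) = a \<odot>\<^bsub>S\<^esub> f (x, \<zero>\<^bsub>B\<^esub>)" if "a \<in> carrier L" "x \<in> carrier A" for a x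
        using fD(3)[of a "(x, \<zero>\<^bsub>B\<^esub>)"] that by (simp add: B.smult_r_null)
    qed
    show "(\<lambda>y\<in>carrier B. f (\<zero>\<^bsub>A\<^esub>, y)) \<in> carrier (mod_hom L B S)"
    proof (rule mod_homI[OF B.left_module_axioms])
      show "f (\<zero>\<^bsub>A\<^esub>, x) \<in> carrier S" if "x \<in> carrier B" for x using fD(1) that by simp
      show "f (\<zero>\<^bsub>A\<^esub>, x \<oplus>\<^bsub>B\<^esub> y) = f (\<zero>\<^bsub>A\<^esub>, x) \<oplus>\<^bsub>S\<^esub> f (\<zero>\<^bsub>A\<^esub>, y)" if "x \<in> carrier B" "y \<in> carrier B" for x y
        using fD(2)[of "(\<zero>\<^bsub>A\<^esub>, x)" "(\<zero>\<^bsub>A\<^esub>, y)"] that by simp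
      show "f (\<zero>\<^bsub>A\<^esub>, a \<odot>\<^bsub>B\<^esub> x) = a \<odot>\<^bsub>S\<^esub> f (\<zero>\<^bsub>A\<^esub>, x)" if "a \<in> carrier L" "x \<in> carrier B" for a x
        using fD(3)[of a "(\<zero>\<^bsub>A\<^esub>, x)"] that by (simp add: A.smult_r_null)
    qed
    show "(\<lambda>s\<in>carrier S. fst (g s)) \<in> carrier (mod_hom L S A)"
      using gc gD(2,3) by (intro mod_homI S.left_module_axioms) simp_all
    show "(\<lambda>s\<in>carrier S. snd (g s)) \<in> carrier (mod_hom L S B)"
      using gc gD(2,3) by (intro mod_homI S.left_module_axioms) simp_all
    show "(\<lambda>x\<in>carrier A. f (x, \<zero>\<^bsub>B\<^esub>)) ((\<lambda>s\<in>carrier S. fst (g s)) s) \<oplus>\<^bsub>S\<^esub>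
        (\<lambda>y\<in>carrier B. f (\<zero>\<^bsub>A\<^esub>, y)) ((\<lambda>s\<in>carrier S. snd (g s)) s) = s" if s: "s \<in> carrier S" for s
    proof -
      have "f (fst (g s), \<zero>\<^bsub>B\<^esub>) \<oplus>\<^bsub>S\<^esub> f (\<zero>\<^bsub>A\<^esub>, snd (g s)) = f (g s)"
        using fD(2)[of "(fst (g s), \<zero>\<^bsub>B\<^esub>)" "(\<zero>\<^bsub>A\<^esub>, snd (g s))"] gc[OF s] by simp
      then show ?thesis using gc[OF s] g(3)[OF s] s by simp
    qed
  qed (use fD(1) g(2) in simp_all)
  then show ?thesis using that S by blast
qed

lemma zero_module_exists:
  assumes "ring L"
  obtains Z :: "('a, 'm set) module" where "Z \<in> fgmod L" "carrier Z = {\<zero>\<^bsub>Z\<^esub>}"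
proof -
  interpret ring L by fact
  define Z :: "('a, 'm set) module" where "Z =
    \<lparr>carrier = {{}}, monoid.mult = (\<lambda>_ _. {}), one = {}, zero = {}, add = (\<lambda>_ _. {}), smult = (\<lambda>_ _. {})\<rparr>"
  have "abelian_group Z" by (rule abelian_groupI) (auto simp: Z_def)
  then have Z: "left_module L Z"
    by (intro left_module.intro left_module_axioms.intro assms) (auto simp: Z_def)
  have "finitely_generated_module L Z"
    using left_module.submoduleD(1,2)[OF Z] unfolding finitely_generated_module_def
    by (intro exI[of _ "{}"]) (auto simp: Z_def)
  then show ?thesis using that[of Z] Z by (auto simp: fgmod_def) (auto simp: Z_def)
qed

text \<open>Componentwise biproducts give a direct sum of the two maps. The sum of any two morphisms into \<open>m\<close>
  that factor through \<open>u\<close> and \<open>v\<close> respectively then factors through the single morphism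
  \<open>t = (u, v)\<close>.\<close>

lemma maps_direct_sum:
  fixes L :: "('a, 'c) ring_scheme" and A1 A0 B1 B0 M1 M0 :: "('a, (nat \<Rightarrow> 'a) set) module"
  assumes sub: "subcategory (maps_cat L) \<C>"
    and A: "(A1, A0, a) \<in> \<C>" and B: "(B1, B0, b) \<in> \<C>" and M: "(M1, M0, m) \<in> Obj (maps_cat L)"
    and u: "(u1, u0) \<in> carrier (maps_hom L (A1, A0, a) (M1, M0, m))"
    and v: "(v1, v0) \<in> carrier (maps_hom L (B1, B0, b) (M1, M0, m))"
  obtains S1 S0 s t1 t0 where "(S1, S0, s) \<in> \<C>"
    "(t1, t0) \<in> carrier (maps_hom L (S1, S0, s) (M1, M0, m))"
    "\<forall>D1 D0 d w1 w0 z1 z0. (D1, D0, d) \<in> Obj (maps_cat L) \<longrightarrow>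
       (w1, w0) \<in> carrier (maps_hom L (D1, D0, d) (A1, A0, a)) \<longrightarrow>
       (z1, z0) \<in> carrier (maps_hom L (D1, D0, d) (B1, B0, b)) \<longrightarrow>
     (\<exists>h1 h0. (h1, h0) \<in> carrier (maps_hom L (D1, D0, d) (S1, S0, s)) \<and>
       (\<forall>x\<in>carrier D1. t1 (h1 x) = u1 (w1 x) \<oplus>\<^bsub>M1\<^esub> v1 (z1 x)) \<and>
       (\<forall>x\<in>carrier D0. t0 (h0 x) = u0 (w0 x) \<oplus>\<^bsub>M0\<^esub> v0 (z0 x)))"
proof -
  have AB: "(A1, A0, a) \<in> Obj (maps_cat L)" "(B1, B0, b) \<in> Obj (maps_cat L)"
    using sub[unfolded subcategory_def, THEN conjunct1] A B by auto
  interpret A: map_object L A1 A0 a by unfold_locales fact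
  interpret B: map_object L B1 B0 b by unfold_locales fact
  interpret M: map_object L M1 M0 m by unfold_locales fact
  obtain S1 :: "('a, (nat \<Rightarrow> 'a) set) module" and i1 j1 p1 q1 where S1: "S1 \<in> fgmod L"
    and bp1: "biproduct L A1 B1 S1 i1 j1 p1 q1"
    by (rule biproduct_exists[OF A.A1 B.A1])
  have i1: "i1 \<in> carrier (mod_hom L A1 S1)" and j1: "j1 \<in> carrier (mod_hom L B1 S1)"
    and p1: "p1 \<in> carrier (mod_hom L S1 A1)" and q1: "q1 \<in> carrier (mod_hom L S1 B1)"
    and e1: "\<And>x. x \<in> carrier A1 \<Longrightarrow> p1 (i1 x) = x" "\<And>y. y \<in> carrier B1 \<Longrightarrow> p1 (j1 y) = \<zero>\<^bsub>A1\<^esub>"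
    "\<And>x. x \<in> carrier A1 \<Longrightarrow> q1 (i1 x) = \<zero>\<^bsub>B1\<^esub>" "\<And>y. y \<in> carrier B1 \<Longrightarrow> q1 (j1 y) = y"
    "\<And>s. s \<in> carrier S1 \<Longrightarrow> i1 (p1 s) \<oplus>\<^bsub>S1\<^esub> j1 (q1 s) = s"
    using bp1 by (simp_all add: biproduct_def)
  obtain S0 :: "('a, (nat \<Rightarrow> 'a) set) module" and i0 j0 p0 q0 where S0: "S0 \<in> fgmod L"
    and bp0: "biproduct L A0 B0 S0 i0 j0 p0 q0"
    by (rule biproduct_exists[OF A.A0 B.A0])
  have i0: "i0 \<in> carrier (mod_hom L A0 S0)" and j0: "j0 \<in> carrier (mod_hom L B0 S0)"
    and p0: "p0 \<in> carrier (mod_hom L S0 A0)" and q0: "q0 \<in> carrier (mod_hom L S0 B0)"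
    and e0: "\<And>x. x \<in> carrier A0 \<Longrightarrow> p0 (i0 x) = x" "\<And>y. y \<in> carrier B0 \<Longrightarrow> p0 (j0 y) = \<zero>\<^bsub>A0\<^esub>"
    "\<And>x. x \<in> carrier A0 \<Longrightarrow> q0 (i0 x) = \<zero>\<^bsub>B0\<^esub>" "\<And>y. y \<in> carrier B0 \<Longrightarrow> q0 (j0 y) = y"
    "\<And>s. s \<in> carrier S0 \<Longrightarrow> i0 (p0 s) \<oplus>\<^bsub>S0\<^esub> j0 (q0 s) = s"
    using bp0 by (simp_all add: biproduct_def)
  interpret S1: left_module L S1 using S1 by (rule fgmodD)
  interpret S0: left_module L S0 using S0 by (rule fgmodD)
  note u = maps_homD[OF u] and v = maps_homD[OF v]
  note cl = mod_homD(1)[OF i1] mod_homD(1)[OF j1] mod_homD(1)[OF p1] mod_homD(1)[OF q1]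
    mod_homD(1)[OF i0] mod_homD(1)[OF j0] mod_homD(1)[OF p0] mod_homD(1)[OF q0]
    mod_homD(1)[OF A.f] mod_homD(1)[OF B.f] mod_homD(1)[OF M.f]
    mod_homD(1)[OF u(1)] mod_homD(1)[OF u(2)] mod_homD(1)[OF v(1)] mod_homD(1)[OF v(2)]
  note ad = mod_homD(2)[OF p1] mod_homD(2)[OF q1] mod_homD(2)[OF p0] mod_homD(2)[OF q0]
    mod_homD(2)[OF u(1)] mod_homD(2)[OF u(2)] mod_homD(2)[OF v(1)] mod_homD(2)[OF v(2)] mod_homD(2)[OF M.f]
  note zero = mod_hom_zero[OF A.A1.left_module_axioms A.A0.left_module_axioms A.f]
    mod_hom_zero[OF B.A1.left_module_axioms B.A0.left_module_axioms B.f]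
    mod_hom_zero[OF A.A0.left_module_axioms S0.left_module_axioms i0]
    mod_hom_zero[OF B.A0.left_module_axioms S0.left_module_axioms j0]
  define s where "s = (\<lambda>x\<in>carrier S1. i0 (a (p1 x)) \<oplus>\<^bsub>S0\<^esub> j0 (b (q1 x)))"
  have s: "s \<in> carrier (mod_hom L S1 S0)"
  proof -
    note i = mod_hom_compose[OF S1.left_module_axioms mod_hom_compose[OF S1.left_module_axioms p1 A.f] i0]
    note j = mod_hom_compose[OF S1.left_module_axioms mod_hom_compose[OF S1.left_module_axioms q1 B.f] j0]
    have "s = (\<lambda>x\<in>carrier S1. compose (carrier S1) i0 (compose (carrier S1) a p1) x \<oplus>\<^bsub>S0\<^esub>
       compose (carrier S1) j0 (compose (carrier S1) b q1) x)"
      by (auto simp: s_def compose_def intro!: restrict_ext)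
    then show ?thesis using mod_hom_add[OF S1.left_module_axioms S0.left_module_axioms i j] by simp
  qed
  have S: "(S1, S0, s) \<in> Obj (maps_cat L)" using S1 S0 s by (simp add: maps_cat_def)
  have i: "(i1, i0) \<in> carrier (maps_hom L (A1, A0, a) (S1, S0, s))"
    using cl e1 zero by (intro maps_homI i1 i0) (simp add: s_def)
  have j: "(j1, j0) \<in> carrier (maps_hom L (B1, B0, b) (S1, S0, s))"
    using cl e1 zero by (intro maps_homI j1 j0) (simp add: s_def)
  have p: "(p1, p0) \<in> carrier (maps_hom L (S1, S0, s) (A1, A0, a))"
    using cl e0 ad by (intro maps_homI p1 p0) (simp add: s_def)
  have q: "(q1, q0) \<in> carrier (maps_hom L (S1, S0, s) (B1, B0, b))"
    using cl e0 ad by (intro maps_homI q1 q0) (simp add: s_def)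
  have "direct_sum_in (maps_cat L) (A1, A0, a) (B1, B0, b) (S1, S0, s)"
    unfolding direct_sum_in_def
  proof (intro bexI conjI)
    show "(i1, i0) \<in> carrier (Hom (maps_cat L) (A1, A0, a) (S1, S0, s))"
      "(j1, j0) \<in> carrier (Hom (maps_cat L) (B1, B0, b) (S1, S0, s))"
      "(p1, p0) \<in> carrier (Hom (maps_cat L) (S1, S0, s) (A1, A0, a))"
      "(q1, q0) \<in> carrier (Hom (maps_cat L) (S1, S0, s) (B1, B0, b))"
      using i j p q by (simp_all add: maps_cat_def del: maps_hom.simps)
  qed (use e1 e0 cl in \<open>auto simp: maps_cat_def compose_def intro!: restrict_ext\<close>)
  moreover have "\<forall>A\<in>\<C>. \<forall>B\<in>\<C>. \<forall>S\<in>Obj (maps_cat L). direct_sum_in (maps_cat L) A B S \<longrightarrow> S \<in> \<C>"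
    using sub unfolding subcategory_def by (elim conjE)
  ultimately have SC: "(S1, S0, s) \<in> \<C>" using A B S by blast
  define t1 where "t1 = (\<lambda>x\<in>carrier S1. u1 (p1 x) \<oplus>\<^bsub>M1\<^esub> v1 (q1 x))"
  define t0 where "t0 = (\<lambda>x\<in>carrier S0. u0 (p0 x) \<oplus>\<^bsub>M0\<^esub> v0 (q0 x))"
  have "t1 \<in> carrier (mod_hom L S1 M1)"
    using mod_hom_add[OF S1.left_module_axioms M.A1.left_module_axioms
      mod_hom_compose[OF S1.left_module_axioms p1 u(1)] mod_hom_compose[OF S1.left_module_axioms q1 v(1)]]
    by (simp add: t1_def compose_def cong: restrict_cong)
  moreover have "t0 \<in> carrier (mod_hom L S0 M0)"
    using mod_hom_add[OF S0.left_module_axioms M.A0.left_module_axioms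
      mod_hom_compose[OF S0.left_module_axioms p0 u(2)] mod_hom_compose[OF S0.left_module_axioms q0 v(2)]]
    by (simp add: t0_def compose_def cong: restrict_cong)
  moreover have "m (t1 x) = t0 (s x)" if x: "x \<in> carrier S1" for x
  proof -
    have "p0 (s x) = a (p1 x)" "q0 (s x) = b (q1 x)"
      using maps_homD(3)[OF p x] maps_homD(3)[OF q x] by simp_all
    then show ?thesis using x mod_homD(1)[OF s x] cl ad u(3) v(3) by (simp add: t1_def t0_def)
  qed
  ultimately have t: "(t1, t0) \<in> carrier (maps_hom L (S1, S0, s) (M1, M0, m))" by (rule maps_homI)
  have "\<exists>h1 h0. (h1, h0) \<in> carrier (maps_hom L (D1, D0, d) (S1, S0, s)) \<and>
       (\<forall>x\<in>carrier D1. t1 (h1 x) = u1 (w1 x) \<oplus>\<^bsub>M1\<^esub> v1 (z1 x)) \<and>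
       (\<forall>x\<in>carrier D0. t0 (h0 x) = u0 (w0 x) \<oplus>\<^bsub>M0\<^esub> v0 (z0 x))"
    if D: "(D1, D0, d) \<in> Obj (maps_cat L)"
      and w: "(w1, w0) \<in> carrier (maps_hom L (D1, D0, d) (A1, A0, a))"
      and z: "(z1, z0) \<in> carrier (maps_hom L (D1, D0, d) (B1, B0, b))" for D1 D0 d w1 w0 z1 z0
  proof -
    interpret D: map_object L D1 D0 d by unfold_locales fact
    note w = maps_homD[OF w] and z = maps_homD[OF z]
    note D1' = D.A1.left_module_axioms and D0' = D.A0.left_module_axioms
    note cl' = mod_homD(1)[OF w(1)] mod_homD(1)[OF w(2)] mod_homD(1)[OF z(1)] mod_homD(1)[OF z(2)]
    define h1 where "h1 = (\<lambda>x\<in>carrier D1. i1 (w1 x) \<oplus>\<^bsub>S1\<^esub> j1 (z1 x))"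
    define h0 where "h0 = (\<lambda>x\<in>carrier D0. i0 (w0 x) \<oplus>\<^bsub>S0\<^esub> j0 (z0 x))"
    have "h1 \<in> carrier (mod_hom L D1 S1)"
      using mod_hom_add[OF D1' S1.left_module_axioms mod_hom_compose[OF D1' w(1) i1] mod_hom_compose[OF D1' z(1) j1]]
      by (simp add: h1_def compose_def cong: restrict_cong)
    moreover have "h0 \<in> carrier (mod_hom L D0 S0)"
      using mod_hom_add[OF D0' S0.left_module_axioms mod_hom_compose[OF D0' w(2) i0] mod_hom_compose[OF D0' z(2) j0]]
      by (simp add: h0_def compose_def cong: restrict_cong)
    moreover have "s (h1 x) = h0 (d x)" if x: "x \<in> carrier D1" for x
      using x cl cl' ad e1 w(3) z(3) mod_homD(1)[OF D.f x] by (simp add: s_def h1_def h0_def)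
    ultimately have h: "(h1, h0) \<in> carrier (maps_hom L (D1, D0, d) (S1, S0, s))" by (rule maps_homI)
    have "t1 (h1 x) = u1 (w1 x) \<oplus>\<^bsub>M1\<^esub> v1 (z1 x)" if x: "x \<in> carrier D1" for x
      using x cl cl' ad e1 by (simp add: t1_def h1_def)
    moreover have "t0 (h0 x) = u0 (w0 x) \<oplus>\<^bsub>M0\<^esub> v0 (z0 x)" if x: "x \<in> carrier D0" for x
      using x cl cl' ad e0 by (simp add: t0_def h0_def)
    ultimately show ?thesis using h by (intro exI[of _ h1] exI[of _ h0] conjI ballI)
  qed
  then show ?thesis by (intro that[OF SC t] allI impI)
qed


section \<open>The approximation in the category of maps\<close>

theorem theorem3p9:
  fixes R :: "'r ring"
    and \<Lambda> :: "('r, 'a) module"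
    and \<C> :: "('a, (nat \<Rightarrow> 'a) set) map_obj set"
  assumes "artin_algebra R \<Lambda>"
    and "subcategory (maps_cat \<Lambda>) \<C>"
    and "\<And>M Z. \<lbrakk>M \<in> fgmod \<Lambda>; Z \<in> fgmod \<Lambda>; carrier Z = {\<zero>\<^bsub>Z\<^esub>}\<rbrakk> \<Longrightarrow>
           (M, Z, \<lambda>x\<in>carrier M. \<zero>\<^bsub>Z\<^esub>) \<in> \<C>"
    and "\<And>M. M \<in> fgmod \<Lambda> \<Longrightarrow> (M, M, \<lambda>x\<in>carrier M. x) \<in> \<C>"
    and "contravariantly_finite (modmod_cat \<Lambda>) (Phi_image \<Lambda> \<C>)"
  shows "contravariantly_finite (maps_cat \<Lambda>) \<C>"
  unfolding contravariantly_finite_def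
proof
  fix M :: "('a, (nat \<Rightarrow> 'a) set) map_obj" assume "M \<in> Obj (maps_cat \<Lambda>)"
  moreover obtain M1 M0 m where M_eq: "M = (M1, M0, m)" by (cases M)
  ultimately have M: "(M1, M0, m) \<in> Obj (maps_cat \<Lambda>)" by simp
  interpret M: map_object \<Lambda> M1 M0 m by unfold_locales fact
  have obj: "\<C> \<subseteq> Obj (maps_cat \<Lambda>)" using assms(2)[unfolded subcategory_def, THEN conjunct1] .
  obtain F \<eta> where "right_approximation (modmod_cat \<Lambda>) (Phi_image \<Lambda> \<C>) (Phi \<Lambda> M.A) F \<eta>"
    using assms(5) M.Phi_object unfolding contravariantly_finite_def by blast
  then obtain C1 C0 c u1 u0 where C: "(C1, C0, c) \<in> \<C>" and u: "(u1, u0) \<in> carrier (maps_hom \<Lambda> (C1, C0, c) M.A)"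
    and lift: "\<forall>D1 D0 d v1 v0. (D1, D0, d) \<in> \<C> \<longrightarrow> (v1, v0) \<in> carrier (maps_hom \<Lambda> (D1, D0, d) M.A) \<longrightarrow>
      (\<exists>w1 w0 s. (w1, w0) \<in> carrier (maps_hom \<Lambda> (D1, D0, d) (C1, C0, c)) \<and> s \<in> carrier (mod_hom \<Lambda> D0 M1) \<and>
        (\<forall>x\<in>carrier D0. v0 x = m (s x) \<oplus>\<^bsub>M0\<^esub> u0 (w0 x)))"
    by (rule Phi_approximation_lift[OF M obj])
  let ?id = "\<lambda>x\<in>carrier M1. x"
  have idm: "(?id, m) \<in> carrier (maps_hom \<Lambda> (M1, M1, ?id) M.A)"
    using mod_hom_id[OF M.A1.left_module_axioms] M.f by (intro maps_homI) simp_all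
  obtain S1 S0 s t1 t0 where S: "(S1, S0, s) \<in> \<C>" and t: "(t1, t0) \<in> carrier (maps_hom \<Lambda> (S1, S0, s) M.A)"
    and S_univ: "\<forall>D1 D0 d w1 w0 z1 z0. (D1, D0, d) \<in> Obj (maps_cat \<Lambda>) \<longrightarrow>
       (w1, w0) \<in> carrier (maps_hom \<Lambda> (D1, D0, d) (C1, C0, c)) \<longrightarrow>
       (z1, z0) \<in> carrier (maps_hom \<Lambda> (D1, D0, d) (M1, M1, ?id)) \<longrightarrow>
     (\<exists>h1 h0. (h1, h0) \<in> carrier (maps_hom \<Lambda> (D1, D0, d) (S1, S0, s)) \<and>
       (\<forall>x\<in>carrier D1. t1 (h1 x) = u1 (w1 x) \<oplus>\<^bsub>M1\<^esub> ?id (z1 x)) \<and>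
       (\<forall>x\<in>carrier D0. t0 (h0 x) = u0 (w0 x) \<oplus>\<^bsub>M0\<^esub> m (z0 x)))"
    by (rule maps_direct_sum[OF assms(2) C assms(4)[OF M.A1] M u idm])
  define K where "K = M1\<lparr>carrier := {x \<in> carrier M1. m x = \<zero>\<^bsub>M0\<^esub>}\<rparr>"
  have K: "K \<in> fgmod \<Lambda>" unfolding K_def
    by (rule fgmod_submodule[OF M.A1 artin_algebra_noetherian[OF assms(1)]
          submodule_kernel[OF M.A1.left_module_axioms M.A0.left_module_axioms M.f]])
  interpret K: left_module \<Lambda> K using K by (rule fgmodD)
  obtain Z :: "('a, (nat \<Rightarrow> 'a) set) module" where Z: "Z \<in> fgmod \<Lambda>" "carrier Z = {\<zero>\<^bsub>Z\<^esub>}"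
    using zero_module_exists[OF M.A1.L.ring_axioms] by blast
  interpret Z: left_module \<Lambda> Z using Z(1) by (rule fgmodD)
  let ?incl = "\<lambda>x\<in>carrier K. x" and ?zero = "\<lambda>z\<in>carrier Z. \<zero>\<^bsub>M0\<^esub>" and ?KZ = "\<lambda>x\<in>carrier K. \<zero>\<^bsub>Z\<^esub>"
  have "?incl \<in> carrier (mod_hom \<Lambda> K M1)"
    by (rule mod_homI[OF K.left_module_axioms]) (simp_all add: K_def)
  then have incl: "(?incl, ?zero) \<in> carrier (maps_hom \<Lambda> (K, Z, ?KZ) M.A)"
    using mod_hom_const_zero[OF Z.left_module_axioms M.A0.left_module_axioms]
    by (intro maps_homI) (simp_all add: K_def)
  obtain T1 T0 t r1 r0 where T: "(T1, T0, t) \<in> \<C>" and r: "(r1, r0) \<in> carrier (maps_hom \<Lambda> (T1, T0, t) M.A)"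
    and T_univ: "\<forall>D1 D0 d w1 w0 z1 z0. (D1, D0, d) \<in> Obj (maps_cat \<Lambda>) \<longrightarrow>
       (w1, w0) \<in> carrier (maps_hom \<Lambda> (D1, D0, d) (S1, S0, s)) \<longrightarrow>
       (z1, z0) \<in> carrier (maps_hom \<Lambda> (D1, D0, d) (K, Z, ?KZ)) \<longrightarrow>
     (\<exists>h1 h0. (h1, h0) \<in> carrier (maps_hom \<Lambda> (D1, D0, d) (T1, T0, t)) \<and>
       (\<forall>x\<in>carrier D1. r1 (h1 x) = t1 (w1 x) \<oplus>\<^bsub>M1\<^esub> ?incl (z1 x)) \<and>
       (\<forall>x\<in>carrier D0. r0 (h0 x) = t0 (w0 x) \<oplus>\<^bsub>M0\<^esub> ?zero (z0 x)))"
    by (rule maps_direct_sum[OF assms(2) S assms(3)[OF K Z] M t incl])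
  have factor: "\<exists>h1 h0. (h1, h0) \<in> carrier (maps_hom \<Lambda> (D1, D0, d) (T1, T0, t)) \<and>
      compose (carrier D1) r1 h1 = v1 \<and> compose (carrier D0) r0 h0 = v0"
    if DC: "(D1, D0, d) \<in> \<C>" and v: "(v1, v0) \<in> carrier (maps_hom \<Lambda> (D1, D0, d) M.A)" for D1 D0 d v1 v0
  proof -
    have D: "(D1, D0, d) \<in> Obj (maps_cat \<Lambda>)" using DC obj by blast
    interpret D: map_object \<Lambda> D1 D0 d by unfold_locales fact
    obtain w1 w0 \<sigma> where w: "(w1, w0) \<in> carrier (maps_hom \<Lambda> D.A (C1, C0, c))"
      and \<sigma>: "\<sigma> \<in> carrier (mod_hom \<Lambda> D0 M1)"
      and v0_eq: "\<forall>x\<in>carrier D0. v0 x = m (\<sigma> x) \<oplus>\<^bsub>M0\<^esub> u0 (w0 x)"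
      using lift[rule_format, OF DC v] by blast
    \<comment> \<open>The difference of \<open>v\<close> and \<open>u w\<close> on targets factors through the object \<open>(M\<^sub>1, M\<^sub>1, 1)\<close>.\<close>
    let ?\<sigma>d = "compose (carrier D1) \<sigma> d"
    note D1' = D.A1.left_module_axioms
    have \<sigma>d: "?\<sigma>d \<in> carrier (mod_hom \<Lambda> D1 M1)" using mod_hom_compose[OF D1' D.f \<sigma>] .
    have "(?\<sigma>d, \<sigma>) \<in> carrier (maps_hom \<Lambda> D.A (M1, M1, ?id))"
      using mod_homD(1)[OF D.f] mod_homD(1)[OF \<sigma>] by (intro maps_homI \<sigma>d \<sigma>) (simp add: compose_eq)
    from S_univ[rule_format, OF D w this]
    obtain h1 h0 where h: "(h1, h0) \<in> carrier (maps_hom \<Lambda> D.A (S1, S0, s))"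
      and h1: "\<forall>x\<in>carrier D1. t1 (h1 x) = u1 (w1 x) \<oplus>\<^bsub>M1\<^esub> ?id (?\<sigma>d x)"
      and h0: "\<forall>x\<in>carrier D0. t0 (h0 x) = u0 (w0 x) \<oplus>\<^bsub>M0\<^esub> m (\<sigma> x)" by blast
    note v' = maps_homD[OF v] and h' = maps_homD[OF h] and t' = maps_homD[OF t] and w' = maps_homD[OF w]
      and u' = maps_homD[OF u]
    have h0': "t0 (h0 x) = v0 x" if x: "x \<in> carrier D0" for x
      using h0 v0_eq x mod_homD(1)[OF w'(2) x] mod_homD(1)[OF u'(2)] mod_homD(1)[OF \<sigma> x] mod_homD(1)[OF M.f]
      by (simp add: M.A0.M.a_comm)
    define th where "th = compose (carrier D1) t1 h1"
    have th: "th \<in> carrier (mod_hom \<Lambda> D1 M1)" unfolding th_def using mod_hom_compose[OF D1' h'(1) t'(1)] .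
    \<comment> \<open>The part of \<open>v\<^sub>1\<close> that the first two summands do not reach; it lies in the kernel of \<open>m\<close>.\<close>
    define \<kappa> where "\<kappa> = (\<lambda>x\<in>carrier D1. v1 x \<oplus>\<^bsub>M1\<^esub> \<ominus>\<^bsub>M1\<^esub> th x)"
    have \<kappa>: "\<kappa> \<in> carrier (mod_hom \<Lambda> D1 M1)"
      using mod_hom_add[OF D1' M.A1.left_module_axioms v'(1) mod_hom_neg[OF D1' M.A1.left_module_axioms th]]
      by (simp add: \<kappa>_def cong: restrict_cong)
    have "m (\<kappa> x) = \<zero>\<^bsub>M0\<^esub>" if x: "x \<in> carrier D1" for x
    proof -
      have dx: "d x \<in> carrier D0" using mod_homD(1)[OF D.f x] .
      have "m (th x) = m (v1 x)"
        using t'(3)[OF mod_homD(1)[OF h'(1) x]] h'(3)[OF x] h0'[OF dx] v'(3)[OF x] x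
        by (simp add: th_def compose_eq)
      then show ?thesis
        using x mod_homD(1)[OF v'(1) x] mod_homD(1)[OF th x] mod_homD(1,2)[OF M.f]
          mod_hom_uminus[OF M.A1.left_module_axioms M.A0.left_module_axioms M.f]
        by (simp add: \<kappa>_def M.A0.M.r_neg)
    qed
    then have \<kappa>K: "\<kappa> \<in> carrier (mod_hom \<Lambda> D1 K)"
      using \<kappa> by (auto simp: mod_hom_def K_def PiE_iff)
    have "(\<kappa>, \<lambda>x\<in>carrier D0. \<zero>\<^bsub>Z\<^esub>) \<in> carrier (maps_hom \<Lambda> D.A (K, Z, ?KZ))"
      using mod_homD(1)[OF \<kappa>K] mod_homD(1)[OF D.f]
      by (intro maps_homI \<kappa>K mod_hom_const_zero D.A0.left_module_axioms Z.left_module_axioms) simp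
    from T_univ[rule_format, OF D h this]
    obtain g1 g0 where g: "(g1, g0) \<in> carrier (maps_hom \<Lambda> D.A (T1, T0, t))"
      and g1: "\<forall>x\<in>carrier D1. r1 (g1 x) = t1 (h1 x) \<oplus>\<^bsub>M1\<^esub> ?incl (\<kappa> x)"
      and g0: "\<forall>x\<in>carrier D0. r0 (g0 x) = t0 (h0 x) \<oplus>\<^bsub>M0\<^esub> ?zero ((\<lambda>x\<in>carrier D0. \<zero>\<^bsub>Z\<^esub>) x)" by blast
    have "r1 (g1 x) = v1 x" if x: "x \<in> carrier D1" for x
    proof -
      have "\<kappa> x \<in> carrier K" using \<kappa>K x by (rule mod_homD(1))
      then have "r1 (g1 x) = th x \<oplus>\<^bsub>M1\<^esub> (v1 x \<oplus>\<^bsub>M1\<^esub> \<ominus>\<^bsub>M1\<^esub> th x)"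
        using g1 x by (simp add: \<kappa>_def th_def compose_eq)
      also have "\<dots> = v1 x \<oplus>\<^bsub>M1\<^esub> (th x \<oplus>\<^bsub>M1\<^esub> \<ominus>\<^bsub>M1\<^esub> th x)"
        using mod_homD(1)[OF v'(1) x] mod_homD(1)[OF th x] by (simp add: M.A1.M.a_lcomm)
      finally show ?thesis using mod_homD(1)[OF v'(1) x] mod_homD(1)[OF th x] by (simp add: M.A1.M.r_neg)
    qed
    then have "compose (carrier D1) r1 g1 = v1"
      using mod_homD(4)[OF v'(1)] by (intro extensionalityI[of _ "carrier D1"]) (simp_all add: compose_def)
    moreover have "r0 (g0 x) = v0 x" if x: "x \<in> carrier D0" for x
      using g0 h0' x mod_homD(1)[OF v'(2) x] by simp
    then have "compose (carrier D0) r0 g0 = v0"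
      using mod_homD(4)[OF v'(2)] by (intro extensionalityI[of _ "carrier D0"]) (simp_all add: compose_def)
    ultimately show ?thesis using g by blast
  qed
  have "\<exists>h\<in>carrier (Hom (maps_cat \<Lambda>) D (T1, T0, t)).
      Comp (maps_cat \<Lambda>) D (T1, T0, t) M.A (r1, r0) h = v"
    if D: "D \<in> \<C>" and v: "v \<in> carrier (Hom (maps_cat \<Lambda>) D M.A)" for D v
  proof -
    obtain D1 D0 d v1 v0 where eq: "D = (D1, D0, d)" "v = (v1, v0)" by (cases D, cases v)
    have "(v1, v0) \<in> carrier (maps_hom \<Lambda> (D1, D0, d) M.A)"
      using v by (simp add: eq maps_cat_def del: maps_hom.simps)
    then obtain h1 h0 where "(h1, h0) \<in> carrier (maps_hom \<Lambda> (D1, D0, d) (T1, T0, t))"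
      "compose (carrier D1) r1 h1 = v1" "compose (carrier D0) r0 h0 = v0"
      using factor[OF D[unfolded eq(1)]] by blast
    then show ?thesis
      by (intro bexI[of _ "(h1, h0)"]) (simp_all add: eq maps_cat_def del: maps_hom.simps)
  qed
  moreover have "(r1, r0) \<in> carrier (Hom (maps_cat \<Lambda>) (T1, T0, t) M.A)"
    using r by (simp add: maps_cat_def del: maps_hom.simps)
  ultimately have "right_approximation (maps_cat \<Lambda>) \<C> M.A (T1, T0, t) (r1, r0)"
    unfolding right_approximation_def by (intro conjI ballI T)
  then show "\<exists>A f. right_approximation (maps_cat \<Lambda>) \<C> M A f" unfolding M_eq by blast
qed

end
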